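(* Let $B(t)$, $t\in\mathbb{R}$, be a real-valued, measurable, stochastically continuous process with wide-sense stationary increments, with $B(0)=0$, given by its spectral representation \[ B(t)=D_0t+\int_{\mathbb{R}\setminus\{0\}}(e^{itu}-1)\,X(du), \] with spectral measure $\mu_B$. For $T>0$ let $f_T$ denote the minimizer of \[ \mathcal{E}_T(f,B)=\int_0^T\left[(f(s)-B(s))^2+f'(s)^2\right]ds \] over all $f\in\mathbb{W}_2^1[0,T]$. Then \[ \lim_{T\to\infty}T^{-1}\,\mathbb{E}\,\mathcal{E}_T(f_T,B)=\mathcal{C}, \] where \[ \mathcal{C}:=\mathbb{E}|D_0|^2+\int_{\mathbb{R}\setminus\{0\}}\frac{u^2}{1+u^2}\,\mu_B(du). \]
   Context: A process $B(t)$, $t\in\mathbb{R}$, has stationary increments in the wide sense if it has finite second moments and the mean and the covariance of the process $t\mapsto B(t_0+t)-B(t_0)$ are the same for all $t_0\in\mathbb{R}$. A stochastically continuous such process with $B(0)=0$ admits the spectral representation $B(t)=D_0t+\int_{\mathbb{R}\setminus\{0\}}(e^{itu}-1)X(du)$, where $D_0$ is a (real) random variable with finite second moment and $X$ is a complex-valued zero-mean uncorrelated random measure on $\mathbb{R}\setminus\{0\}$, uncorrelated with $D_0$; since $B$ is real-valued, $X(-A)=\overline{X(A)}$. The spectral measure $\mu_B$ on $\mathbb{R}\setminus\{0\}$ is defined by $\mu_B(A):=\mathbb{E}|X(A)|^2$; it may be infinite but satisfies $\int_{\mathbb{R}\setminus\{0\}}\min(u^2,1)\,\mu_B(du)<\infty$.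 A measurable version of $B$ is always used; its paths belong to $L_2[0,T]$ almost surely for every $T>0$. $\mathbb{W}_2^1[0,T]$ denotes the space of absolutely continuous functions $f:[0,T]\to\mathbb{R}$ with square integrable derivative. For each path in $L_2[0,T]$ the minimizer $f_T$ exists and is unique; it is taken path by path. *)

theory Defs
  imports "HOL-Probability.Probability"
begin

definition finite_second_moment :: "'a measure \<Rightarrow> ('a \<Rightarrow> 'b::{banach, second_countable_topology}) \<Rightarrow> bool" where
  "finite_second_moment M Y \<longleftrightarrow>
     Y \<in> borel_measurable M \<and> integrable M (\<lambda>\<omega>. (norm (Y \<omega>))\<^sup>2)"

definition covariance :: "'a measure \<Rightarrow> ('a \<Rightarrow> real) \<Rightarrow> ('a \<Rightarrow> real) \<Rightarrow> real" where
  "covariance M Y Z =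
     (LINT \<omega>|M. (Y \<omega> - (LINT \<omega>'|M. Y \<omega>')) * (Z \<omega> - (LINT \<omega>'|M. Z \<omega>')))"

definition complex_covariance :: "'a measure \<Rightarrow> ('a \<Rightarrow> complex) \<Rightarrow> ('a \<Rightarrow> complex) \<Rightarrow> complex" where
  "complex_covariance M Y Z =
     (LINT \<omega>|M. (Y \<omega> - (LINT \<omega>'|M. Y \<omega>')) * cnj (Z \<omega> - (LINT \<omega>'|M. Z \<omega>')))"


section \<open>Real-valued processes on the real line\<close>

definition measurable_process :: "'a measure \<Rightarrow> (real \<Rightarrow> 'a \<Rightarrow> real) \<Rightarrow> bool" where
  "measurable_process M B \<longleftrightarrow> (\<lambda>(t, \<omega>). B t \<omega>) \<in> borel_measurable (borel \<Otimes>\<^sub>M M)"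

definition stochastically_continuous :: "'a measure \<Rightarrow> (real \<Rightarrow> 'a \<Rightarrow> real) \<Rightarrow> bool" where
  "stochastically_continuous M B \<longleftrightarrow>
     (\<forall>t\<^sub>0. \<forall>\<epsilon>>0. ((\<lambda>t. measure M {\<omega> \<in> space M. \<bar>B t \<omega> - B t\<^sub>0 \<omega>\<bar> > \<epsilon>}) \<longlongrightarrow> 0) (at t\<^sub>0))"

definition wide_sense_stationary_increments :: "'a measure \<Rightarrow> (real \<Rightarrow> 'a \<Rightarrow> real) \<Rightarrow> bool" where
  "wide_sense_stationary_increments M B \<longleftrightarrow>
     (\<forall>t. finite_second_moment M (B t)) \<and>
     (\<exists>m. \<forall>t\<^sub>0 t. (LINT \<omega>|M. B (t\<^sub>0 + t) \<omega> - B t\<^sub>0 \<omega>) = m t) \<and>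
     (\<exists>K. \<forall>t\<^sub>0 s t. covariance M (\<lambda>\<omega>. B (t\<^sub>0 + s) \<omega> - B t\<^sub>0 \<omega>) (\<lambda>\<omega>. B (t\<^sub>0 + t) \<omega> - B t\<^sub>0 \<omega>) = K s t)"


section \<open>Uncorrelated random measures and stochastic integrals\<close>

text \<open>The measure \<open>\<mu>\<close> may be infinite, so \<open>X A\<close> is meaningful only for the sets \<open>A\<close> with
  \<open>\<mu> A < \<infinity>\<close>; the values of \<open>X\<close> at all other sets are unconstrained.
  Countable additivity is in the mean-square sense.\<close>

definition uncorrelated_random_measure ::
    "'a measure \<Rightarrow> real measure \<Rightarrow> (real set \<Rightarrow> 'a \<Rightarrow> complex) \<Rightarrow> bool" where
  "uncorrelated_random_measure M \<mu> X \<longleftrightarrow>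
     (\<forall>A\<in>sets \<mu>. emeasure \<mu> A < \<infinity> \<longrightarrow>
        finite_second_moment M (X A) \<and>
        (LINT \<omega>|M. X A \<omega>) = 0 \<and>
        emeasure \<mu> A = ennreal (LINT \<omega>|M. (cmod (X A \<omega>))\<^sup>2)) \<and>
     (\<forall>A\<in>sets \<mu>. \<forall>A'\<in>sets \<mu>. emeasure \<mu> A < \<infinity> \<longrightarrow> emeasure \<mu> A' < \<infinity> \<longrightarrow> A \<inter> A' = {} \<longrightarrow>
        complex_covariance M (X A) (X A') = 0) \<and>
     (\<forall>A. range A \<subseteq> sets \<mu> \<longrightarrow> disjoint_family A \<longrightarrow> emeasure \<mu> (\<Union>i. A i) < \<infinity> \<longrightarrow>
        (\<lambda>n. \<integral>\<^sup>+\<omega>. ennreal ((cmod (X (\<Union>i. A i) \<omega> - (\<Sum>i<n::nat. X (A i) \<omega>)))\<^sup>2) \<partial>M)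
          \<longlonglongrightarrow> 0)"

text \<open>The stochastic integral is defined for simple functions and extended by mean-square limits;
  it is thus a class of almost surely equal random variables, of which \<open>Y\<close> is one.
  In the first definition the value \<open>z = 0\<close>, for which the level set may have infinite measure,
  contributes nothing.\<close>

definition simple_stochastic_integral ::
    "real measure \<Rightarrow> (real set \<Rightarrow> 'a \<Rightarrow> complex) \<Rightarrow> (real \<Rightarrow> complex) \<Rightarrow> 'a \<Rightarrow> complex" where
  "simple_stochastic_integral \<mu> X s \<omega> =
     (\<Sum>z\<in>s ` space \<mu>. z * X (s -` {z} \<inter> space \<mu>) \<omega>)"

definition has_stochastic_integral ::
    "'a measure \<Rightarrow> real measure \<Rightarrow> (real set \<Rightarrow> 'a \<Rightarrow> complex) \<Rightarrow> (real \<Rightarrow> complex) \<Rightarrow> ('a \<Rightarrow> complex) \<Rightarrow> bool" where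
  "has_stochastic_integral M \<mu> X g Y \<longleftrightarrow>
     g \<in> borel_measurable \<mu> \<and> Y \<in> borel_measurable M \<and>
     (\<exists>s. (\<forall>n::nat. simple_function \<mu> (s n) \<and> emeasure \<mu> {u \<in> space \<mu>. s n u \<noteq> 0} < \<infinity>) \<and>
        (\<lambda>n. \<integral>\<^sup>+u. ennreal ((cmod (g u - s n u))\<^sup>2) \<partial>\<mu>) \<longlonglongrightarrow> 0 \<and>
        (\<lambda>n. \<integral>\<^sup>+\<omega>. ennreal ((cmod (Y \<omega> - simple_stochastic_integral \<mu> X (s n) \<omega>))\<^sup>2) \<partial>M) \<longlonglongrightarrow> 0)"

text \<open>The spectral measure \<open>\<mu>\<close> is a Borel measure on the punctured line.\<close>

definition spectral_representation ::
    "'a measure \<Rightarrow> (real \<Rightarrow> 'a \<Rightarrow> real) \<Rightarrow> ('a \<Rightarrow> real) \<Rightarrow> (real set \<Rightarrow> 'a \<Rightarrow> complex) \<Rightarrow> real measure \<Rightarrow> bool" where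
  "spectral_representation M B D\<^sub>0 X \<mu> \<longleftrightarrow>
     sets \<mu> = sets (restrict_space borel (- {0})) \<and>
     (\<integral>\<^sup>+u. ennreal (min (u\<^sup>2) 1) \<partial>\<mu>) < \<infinity> \<and>
     uncorrelated_random_measure M \<mu> X \<and>
     (\<forall>A\<in>sets \<mu>. emeasure \<mu> A < \<infinity> \<longrightarrow> (AE \<omega> in M. X (uminus ` A) \<omega> = cnj (X A \<omega>))) \<and>
     finite_second_moment M D\<^sub>0 \<and>
     (\<forall>A\<in>sets \<mu>. emeasure \<mu> A < \<infinity> \<longrightarrow>
        complex_covariance M (\<lambda>\<omega>. complex_of_real (D\<^sub>0 \<omega>)) (X A) = 0) \<and>
     (\<forall>t. has_stochastic_integral M \<mu> X (\<lambda>u. exp (\<i> * of_real (t * u)) - 1)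
            (\<lambda>\<omega>. of_real (B t \<omega> - D\<^sub>0 \<omega> * t)))"


section \<open>The energy and its minimizer\<close>

definition absolutely_continuous_on :: "real \<Rightarrow> real \<Rightarrow> (real \<Rightarrow> real) \<Rightarrow> bool" where
  "absolutely_continuous_on a b f \<longleftrightarrow>
     (\<forall>\<epsilon>>0. \<exists>\<delta>>0. \<forall>I. finite I \<longrightarrow>
        (\<forall>(x, y)\<in>I. a \<le> x \<and> x \<le> y \<and> y \<le> b) \<longrightarrow>
        pairwise (\<lambda>(x, y) (x', y'). {x<..<y} \<inter> {x'<..<y'} = {}) I \<longrightarrow>
        (\<Sum>(x, y)\<in>I. y - x) < \<delta> \<longrightarrow> (\<Sum>(x, y)\<in>I. \<bar>f y - f x\<bar>) < \<epsilon>)"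

text \<open>Elements of \<open>W21 T\<close> are total functions, of which only the restriction to \<open>[0, T]\<close> matters.
  Since \<open>deriv f\<close> has an arbitrary value where \<open>f\<close> is not differentiable, it is made explicit
  that the derivative exists almost everywhere (which absolute continuity implies).
  Integrals are with respect to the completed Lebesgue measure, so the arbitrary values
  on a null set are harmless.\<close>

definition W21 :: "real \<Rightarrow> (real \<Rightarrow> real) set" where
  "W21 T = {f. absolutely_continuous_on 0 T f \<and>
               (AE s in lebesgue. s \<in> {0<..<T} \<longrightarrow> f differentiable (at s)) \<and>
               set_integrable lebesgue {0..T} (\<lambda>s. (deriv f s)\<^sup>2)}"

definition energy :: "real \<Rightarrow> (real \<Rightarrow> real) \<Rightarrow> (real \<Rightarrow> real) \<Rightarrow> real" where
  "energy T f b = (LINT s:{0..T}|lebesgue. (f s - b s)\<^sup>2 + (deriv f s)\<^sup>2)"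

text \<open>On \<open>[0, T]\<close> the minimizer is unique for \<open>b\<close> in \<open>L\<^sub>2[0, T]\<close>; the choice made by \<open>arg_min\<close> only
  concerns its values outside \<open>[0, T]\<close> and does not affect the energy.\<close>

definition energy_minimizer :: "real \<Rightarrow> (real \<Rightarrow> real) \<Rightarrow> real \<Rightarrow> real" where
  "energy_minimizer T b = arg_min (\<lambda>f. energy T f b) (\<lambda>f. f \<in> W21 T)"

end

theory Submission
  imports Defs "HOL-Real_Asymp.Real_Asymp"
begin

text \<open>
  For one path \<open>b\<close> in \<open>L\<^sub>2[0, T]\<close> the energy is a convex quadratic functional of \<open>f\<close>, with
  Euler-Lagrange equation \<open>f'' = f - b\<close> and natural boundary conditions \<open>f' 0 = f' T = 0\<close>.  Its
  solution is \<open>f t = \<integral> G(t, s) b(s) ds\<close> with the Neumann Green function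
  \<open>G(t, s) = cosh (min t s) cosh (T - max t s) / sinh T\<close>, and completing the square shows that this
  is the minimizer, with energy \<open>\<integral> b (b - f)\<close>.  Since \<open>G\<close> is symmetric and
  \<open>\<integral> G(t, s) ds = 1\<close>, the minimal energy is the Dirichlet-type form
  \<open>1/2 \<integral>\<integral> G(t, s) (b(t) - b(s))\<^sup>2 ds dt\<close> (\<open>min_energy_eq\<close>).

  This form is nonnegative and involves only increments of the path, so by Tonelli its expectation is
  the same form with \<open>(b(t) - b(s))\<^sup>2\<close> replaced by \<open>V \<bar>t - s\<bar>\<close>.  Stationarity
  (\<open>second_moment_increment\<close>) and the isometry of the stochastic integral
  (\<open>spectral_second_moment\<close>) give
  \<open>V r = E B(r)\<^sup>2 = r\<^sup>2 E D\<^sub>0\<^sup>2 + \<integral> \<bar>exp (i r u) - 1\<bar>\<^sup>2 \<mu>(du)\<close>.  Integrating \<open>G\<close> over all pairs of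
  times with the same lag \<open>r\<close> yields, for every \<open>T > 0\<close>, the exact formula
  \<open>E energy / T = \<integral> w\<^sub>T(r) V(r) dr\<close> with an elementary weight \<open>w\<^sub>T\<close> on \<open>[0, T]\<close>
  (\<open>expected_min_energy\<close>).

  As \<open>T\<close> grows, \<open>w\<^sub>T(r)\<close> tends to \<open>exp (- r) / 2\<close> and stays below \<open>4 exp (- r)\<close> once \<open>T \<ge> 1\<close>.  By dominated
  convergence the limit is \<open>1/2 \<integral>\<^sub>0\<^sup>\<infinity> exp (- r) V(r) dr\<close>, and the Laplace transforms
  \<open>1/2 \<integral>\<^sub>0\<^sup>\<infinity> exp (- r) r\<^sup>2 dr = 1\<close> and
  \<open>1/2 \<integral>\<^sub>0\<^sup>\<infinity> exp (- r) (2 - 2 cos (r u)) dr = u\<^sup>2 / (1 + u\<^sup>2)\<close> turn it into the constant of the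
  theorem (\<open>structure_function_laplace\<close>).
\<close>

section \<open>Absolutely continuous functions\<close>

text \<open>The fundamental theorem is proved directly for the Henstock-Kurzweil integral.  At points where
  \<open>f\<close> is differentiable the gauge is the usual one, so that the increment of \<open>f\<close> over a tagged
  interval is close to derivative times length.  The other points form a null set \<open>N\<close>; it is covered
  by an open set of small measure, and the gauge forces intervals tagged in \<open>N\<close> into that set.  Their
  total length is then small, and absolute continuity makes their contribution to
  \<open>f b - f a\<close> small.\<close>

lemma absolutely_continuous_on_FTC:
  assumes ac: "absolutely_continuous_on a b f" and ab: "a \<le> b"
    and diff: "AE s in lebesgue. s \<in> {a<..<b} \<longrightarrow> f differentiable (at s)"
  shows "(deriv f has_integral (f b - f a)) {a..b}"
proof -
  define N where "N = {s \<in> {a..b}. \<not> f differentiable (at s)}"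
  obtain N' where N': "\<And>s. s \<in> space lebesgue - N' \<Longrightarrow> s \<in> {a<..<b} \<longrightarrow> f differentiable (at s)"
    "N' \<in> null_sets lebesgue"
    using AE_E3[OF diff] by blast
  then have "negligible (N' \<union> {a, b})"
    by (intro negligible_Un) (auto simp: negligible_iff_null_sets)
  moreover have "N \<subseteq> N' \<union> {a, b}"
    using N'(1) by (force simp: N_def)
  ultimately have N: "negligible N"
    by (rule negligible_subset)
  define g where "g s = (if s \<in> N then 0 else deriv f s)" for s
  have "(g has_integral (f b - f a)) {a..b}"
    unfolding has_integral_real
  proof (intro allI impI)
    fix e :: real assume e: "e > 0"
    define e1 where "e1 = e / (2 * (b - a + 1))"
    \<comment> \<open>The \<open>+ 1\<close> keeps the constant meaningful when \<open>a = b\<close>.\<close>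
    have e1: "e1 > 0"
      using e ab by (simp add: e1_def)
    have "e1 * (b - a) < e1 * (b - a + 1)"
      using e1 by (intro mult_strict_left_mono) auto
    also have "\<dots> = e / 2"
    proof -
      have "e / (2 * c) * c = e / 2" if "c > 0" for c using that by simp
      from this[of "b - a + 1"] show ?thesis using ab by (simp only: e1_def)
    qed
    finally have e2: "e1 * (b - a) < e / 2" .
    obtain \<delta> where \<delta>: "\<delta> > 0" and ac':
      "\<And>I. \<lbrakk>finite I; \<forall>(x, y)\<in>I. a \<le> x \<and> x \<le> y \<and> y \<le> b;
         pairwise (\<lambda>(x, y) (x', y'). {x<..<y} \<inter> {x'<..<y'} = {}) I;
         (\<Sum>(x, y)\<in>I. y - x) < \<delta>\<rbrakk> \<Longrightarrow> (\<Sum>(x, y)\<in>I. \<bar>f y - f x\<bar>) < e / 2"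
      using ac[unfolded absolutely_continuous_on_def, rule_format, of "e / 2"] e by auto
    have N0: "N \<in> null_sets lebesgue"
      using N negligible_iff_null_sets by blast
    obtain U where U: "open U" "N \<subseteq> U" "U \<in> lmeasurable" "measure lebesgue U < \<delta>"
    proof -
      obtain U where U: "open U" "N \<subseteq> U" "U - N \<in> lmeasurable" "emeasure lebesgue (U - N) < ennreal \<delta>"
        using sets_lebesgue_outer_open[of N \<delta>] N0 \<delta> by blast
      have U': "U \<in> sets lebesgue" using U(1) by auto
      have eq: "emeasure lebesgue (U - N) = emeasure lebesgue U"
        using N0 U' by (rule emeasure_Diff_null_set)
      have "U \<in> lmeasurable"
        using U U' eq by (auto simp: fmeasurable_def)
      moreover have "measure lebesgue U < \<delta>"
        using U(4) eq \<open>U \<in> lmeasurable\<close> by (simp add: emeasure_eq_measure2 \<delta> ennreal_less_iff)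
      ultimately show ?thesis using that U by blast
    qed
    have "\<exists>d>0. x \<in> {a..b} - N \<longrightarrow>
       (\<forall>y. \<bar>y - x\<bar> < d \<longrightarrow> \<bar>f y - f x - (y - x) * deriv f x\<bar> \<le> e1 * \<bar>y - x\<bar>)" for x
    proof (cases "x \<in> {a..b} - N")
      case True
      then have "f differentiable (at x)" by (auto simp: N_def)
      then have "(f has_field_derivative deriv f x) (at x)"
        by (simp add: DERIV_deriv_iff_real_differentiable)
      then have "(f has_derivative (\<lambda>h. h * deriv f x)) (at x)"
        by (simp add: has_field_derivative_def mult.commute[of _ "deriv f x"] cong: if_cong)
      then show ?thesis
        using e1 unfolding has_derivative_at_alt by auto
    qed (auto intro: exI[of _ 1])
    then obtain d where d: "\<And>x. d x > 0" "\<And>x y. x \<in> {a..b} - N \<Longrightarrow> \<bar>y - x\<bar> < d x \<Longrightarrow>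
        \<bar>f y - f x - (y - x) * deriv f x\<bar> \<le> e1 * \<bar>y - x\<bar>"
      by metis
    define \<gamma> where "\<gamma> x = (if x \<in> N then U else ball x (d x))" for x
    have \<gamma>: "gauge \<gamma>"
      using U d(1) by (auto simp: gauge_def \<gamma>_def)
    show "\<exists>\<gamma>. gauge \<gamma> \<and> (\<forall>D. D tagged_division_of {a..b} \<and> \<gamma> fine D \<longrightarrow>
             norm ((\<Sum>(x, k)\<in>D. measure lborel k *\<^sub>R g x) - (f b - f a)) < e)"
    proof (intro exI[of _ \<gamma>] conjI \<gamma> allI impI, elim conjE)
      fix D assume D: "D tagged_division_of {a..b}" and fine: "\<gamma> fine D"
      have K: "\<exists>u v. u \<le> v \<and> K = {u..v} \<and> Inf K = u \<and> Sup K = v \<and> u \<le> x \<and> x \<le> v \<and> a \<le> u \<and> v \<le> b \<and> K \<subseteq> \<gamma> x"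
        if xK: "(x, K) \<in> D" for x K
      proof -
        obtain u v where uv: "K = cbox u v" using tagged_division_ofD(4)[OF D xK] by blast
        have x: "x \<in> K" using tagged_division_ofD(2)[OF D xK] .
        have "K \<subseteq> {a..b}" using tagged_division_ofD(3)[OF D xK] .
        moreover have "K \<subseteq> \<gamma> x" using fine xK by (auto simp: fine_def)
        ultimately show ?thesis using x uv by (intro exI[of _ u] exI[of _ v]) auto
      qed
      have fin: "finite D" using tagged_division_ofD(1)[OF D] .
      \<comment> \<open>Degenerate intervals contribute nothing and are left out, so that an interval in \<open>?D2\<close> determines its tag.\<close>
      let ?D2 = "{(x, K) \<in> D. x \<in> N \<and> Inf K < Sup K}"
      have "(\<Sum>(x, K)\<in>D. measure lborel K *\<^sub>R g x) - (f b - f a) =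
          (\<Sum>(x, K)\<in>D. measure lborel K *\<^sub>R g x - (f (Sup K) - f (Inf K)))"
        using additive_tagged_division_1[OF ab D, of f]
        by (simp add: sum_subtractf case_prod_unfold)
      also have "\<bar>\<dots>\<bar> \<le> (\<Sum>(x, K)\<in>D. e1 * (Sup K - Inf K) +
          (if (x, K) \<in> ?D2 then \<bar>f (Sup K) - f (Inf K)\<bar> else 0))"
      proof (rule order_trans[OF sum_abs sum_mono], clarify)
        fix x K assume xK: "(x, K) \<in> D"
        obtain u v where uv: "u \<le> v" "K = {u..v}" "Inf K = u" "Sup K = v" "u \<le> x" "x \<le> v" "a \<le> u" "v \<le> b"
          "K \<subseteq> \<gamma> x" using K[OF xK] by blast
        show "\<bar>measure lborel K *\<^sub>R g x - (f (Sup K) - f (Inf K))\<bar> \<le> e1 * (Sup K - Inf K) +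
          (if (x, K) \<in> ?D2 then \<bar>f (Sup K) - f (Inf K)\<bar> else 0)"
        proof (cases "x \<in> N")
          case True
          have "0 \<le> e1 * (v - u)" using uv e1 by simp
          then show ?thesis using uv xK True
            by (cases "u = v") (auto simp: g_def abs_minus_commute[of "f u"])
        next
          case False
          have sub: "\<bar>u - x\<bar> < d x" "\<bar>v - x\<bar> < d x"
          proof -
            have "u \<in> ball x (d x)" "v \<in> ball x (d x)"
              using subsetD[OF uv(9), of u] subsetD[OF uv(9), of v] uv(1,2) False
              by (auto simp only: \<gamma>_def atLeastAtMost_iff order_refl if_False)
            then show "\<bar>u - x\<bar> < d x" "\<bar>v - x\<bar> < d x"
              by (auto simp: dist_real_def abs_minus_commute)
          qed
          have "\<bar>f u - f x - (u - x) * deriv f x\<bar> \<le> e1 * (x - u)"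
               "\<bar>f v - f x - (v - x) * deriv f x\<bar> \<le> e1 * (v - x)"
            using d(2)[of x u] d(2)[of x v] sub False uv by auto
          then have "\<bar>(v - u) * deriv f x - (f v - f u)\<bar> \<le> e1 * (v - u)"
            by (simp add: algebra_simps abs_le_iff)
          then show ?thesis using uv False by (simp add: g_def)
        qed
      qed
      also have "\<dots> = e1 * (b - a) + (\<Sum>(x, K)\<in>D. if (x, K) \<in> ?D2 then \<bar>f (Sup K) - f (Inf K)\<bar> else 0)"
        using additive_tagged_division_1[OF ab D, of "\<lambda>x. x"]
        by (simp add: sum.distrib sum_distrib_left[symmetric] case_prod_unfold)
      also have "(\<Sum>(x, K)\<in>D. if (x, K) \<in> ?D2 then \<bar>f (Sup K) - f (Inf K)\<bar> else 0) =
          (\<Sum>(x, K)\<in>?D2. \<bar>f (Sup K) - f (Inf K)\<bar>)"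
        using fin by (intro sum.mono_neutral_cong_right) (auto split: if_splits)
      also have "\<dots> < e / 2"
      proof -
        let ?\<phi> = "\<lambda>(x::real, K::real set). (Inf K, Sup K)"
        have fin2: "finite ?D2" using fin by (rule rev_finite_subset) auto
        have disj: "{Inf K<..<Sup K} \<inter> {Inf K'<..<Sup K'} = {}"
          if "(x, K) \<in> D" "(x', K') \<in> D" "(x, K) \<noteq> (x', K')" for x K x' K'
        proof -
          have "interior K \<inter> interior K' = {}" using tagged_division_ofD(5)[OF D that] .
          moreover have "interior L = {Inf L<..<Sup L}" if yL: "(y, L) \<in> D" for y L
          proof -
            obtain u v where "L = {u..v}" "Inf L = u" "Sup L = v" using K[OF yL] by blast
            then show ?thesis by simp
          qed
          note this[OF that(1)] this[OF that(2)]
          ultimately show ?thesis by simp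
        qed
        have inj: "inj_on ?\<phi> ?D2"
        proof (rule inj_onI, clarsimp, rule ccontr)
          fix x K x' K'
          assume *: "(x, K) \<in> D" "(x', K') \<in> D" "Inf K = Inf K'" "Sup K = Sup K'" "Inf K' < Sup K'"
            "\<not> (x = x' \<and> K = K')"
          then have "{Inf K<..<Sup K} \<inter> {Inf K'<..<Sup K'} = {}" by (intro disj) auto
          then show False using * by simp
        qed
        have "(\<Sum>(x, K)\<in>?D2. Sup K - Inf K) = (\<Sum>z\<in>?D2. measure lebesgue {Inf (snd z)<..<Sup (snd z)})"
          by (intro sum.cong) auto
        also have "\<dots> = measure lebesgue (\<Union>z\<in>?D2. {Inf (snd z)<..<Sup (snd z)})"
        proof (rule measure_finite_Union[symmetric])
          show "disjoint_family_on (\<lambda>z. {Inf (snd z)<..<Sup (snd z)}) ?D2"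
            using disj by (auto simp: disjoint_family_on_def)
        qed (use fin2 in auto)
        also have "\<dots> \<le> measure lebesgue U"
        proof (rule measure_mono_fmeasurable)
          show "(\<Union>z\<in>?D2. {Inf (snd z)<..<Sup (snd z)}) \<subseteq> U"
          proof clarsimp
            fix x K y assume *: "(x, K) \<in> D" "x \<in> N" "Inf K < y" "y < Sup K"
            then show "y \<in> U" using K[OF *(1)] by (auto simp: \<gamma>_def)
          qed
        qed (use U fin2 in \<open>auto intro!: sets.finite_UN\<close>)
        also have "\<dots> < \<delta>" by (rule U(4))
        also have "(\<Sum>(x, K)\<in>?D2. Sup K - Inf K) = (\<Sum>(x, y)\<in>?\<phi> ` ?D2. y - x)"
          by (rule sum.reindex_cong[OF inj refl, symmetric]) auto
        finally have "(\<Sum>(x, y)\<in>?\<phi> ` ?D2. y - x) < \<delta>" .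
        then have "(\<Sum>(x, y)\<in>?\<phi> ` ?D2. \<bar>f y - f x\<bar>) < e / 2"
        proof (intro ac')
          show "\<forall>(x, y)\<in>?\<phi> ` ?D2. a \<le> x \<and> x \<le> y \<and> y \<le> b"
          proof clarify
            fix x K assume "(x, K) \<in> D"
            then show "a \<le> Inf K \<and> Inf K \<le> Sup K \<and> Sup K \<le> b" using K by blast
          qed
          show "pairwise (\<lambda>(x, y) (x', y'). {x<..<y} \<inter> {x'<..<y'} = {}) (?\<phi> ` ?D2)"
          proof (rule pairwiseI)
            fix p p' assume "p \<in> ?\<phi> ` ?D2" "p' \<in> ?\<phi> ` ?D2" and ne: "p \<noteq> p'"
            then obtain z z' where z: "z \<in> ?D2" "p = ?\<phi> z" "z' \<in> ?D2" "p' = ?\<phi> z'"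
              by (elim imageE) simp
            obtain x K x' K' where zx: "z = (x, K)" "z' = (x', K')"
              by (cases z; cases z') simp
            have p: "p = (Inf K, Sup K)" "p' = (Inf K', Sup K')" using z zx by auto
            have "(x, K) \<in> D" "(x', K') \<in> D" using z zx by auto
            moreover have "(x, K) \<noteq> (x', K')" using ne p by auto
            ultimately have "{Inf K<..<Sup K} \<inter> {Inf K'<..<Sup K'} = {}" by (intro disj)
            then show "(\<lambda>(x, y) (x', y'). {x<..<y} \<inter> {x'<..<y'} = {}) p p'"
              unfolding p by simp
          qed
        qed (use fin2 in auto)
        also have "(\<Sum>(x, y)\<in>?\<phi> ` ?D2. \<bar>f y - f x\<bar>) = (\<Sum>(x, K)\<in>?D2. \<bar>f (Sup K) - f (Inf K)\<bar>)"
          by (rule sum.reindex_cong[OF inj refl]) auto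
        finally show ?thesis .
      qed
      finally show "norm ((\<Sum>(x, k)\<in>D. measure lborel k *\<^sub>R g x) - (f b - f a)) < e"
        using e2 by simp
    qed
  qed
  then show ?thesis
    by (rule has_integral_spike[OF N, rotated]) (auto simp: g_def)
qed

lemma absolutely_continuous_on_subset:
  assumes "absolutely_continuous_on a b f" "a \<le> c" "d \<le> b"
  shows "absolutely_continuous_on c d f"
  unfolding absolutely_continuous_on_def
proof (intro allI impI)
  fix \<epsilon> :: real assume "\<epsilon> > 0"
  then obtain \<delta> where \<delta>: "\<delta> > 0" "\<And>I. \<lbrakk>finite I; \<forall>(x, y)\<in>I. a \<le> x \<and> x \<le> y \<and> y \<le> b;
         pairwise (\<lambda>(x, y) (x', y'). {x<..<y} \<inter> {x'<..<y'} = {}) I;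
         (\<Sum>(x, y)\<in>I. y - x) < \<delta>\<rbrakk> \<Longrightarrow> (\<Sum>(x, y)\<in>I. \<bar>f y - f x\<bar>) < \<epsilon>"
    using assms(1) unfolding absolutely_continuous_on_def by meson
  show "\<exists>\<delta>>0. \<forall>I. finite I \<longrightarrow> (\<forall>(x, y)\<in>I. c \<le> x \<and> x \<le> y \<and> y \<le> d) \<longrightarrow>
        pairwise (\<lambda>(x, y) (x', y'). {x<..<y} \<inter> {x'<..<y'} = {}) I \<longrightarrow>
        (\<Sum>(x, y)\<in>I. y - x) < \<delta> \<longrightarrow> (\<Sum>(x, y)\<in>I. \<bar>f y - f x\<bar>) < \<epsilon>"
  proof (intro exI[of _ \<delta>] conjI allI impI)
    fix I assume I: "finite I" "\<forall>(x, y)\<in>I. c \<le> x \<and> x \<le> y \<and> y \<le> d"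
      "pairwise (\<lambda>(x, y) (x', y'). {x<..<y} \<inter> {x'<..<y'} = {}) I" "(\<Sum>(x, y)\<in>I. y - x) < \<delta>"
    have "\<forall>(x, y)\<in>I. a \<le> x \<and> x \<le> y \<and> y \<le> b"
      using I(2) assms(2,3) by force
    then show "(\<Sum>(x, y)\<in>I. \<bar>f y - f x\<bar>) < \<epsilon>"
      using I \<delta>(2) by simp
  qed (rule \<delta>(1))
qed

lemma absolutely_continuous_on_imp_continuous_on:
  assumes "absolutely_continuous_on a b f"
  shows "continuous_on {a..b} f"
  unfolding continuous_on_iff
proof (intro ballI allI impI)
  fix x \<epsilon> :: real assume x: "x \<in> {a..b}" and "\<epsilon> > 0"
  then obtain \<delta> where \<delta>: "\<delta> > 0" "\<And>I. \<lbrakk>finite I; \<forall>(x, y)\<in>I. a \<le> x \<and> x \<le> y \<and> y \<le> b;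
         pairwise (\<lambda>(x, y) (x', y'). {x<..<y} \<inter> {x'<..<y'} = {}) I;
         (\<Sum>(x, y)\<in>I. y - x) < \<delta>\<rbrakk> \<Longrightarrow> (\<Sum>(x, y)\<in>I. \<bar>f y - f x\<bar>) < \<epsilon>"
    using assms unfolding absolutely_continuous_on_def by meson
  have "dist (f y) (f x) < \<epsilon>" if "y \<in> {a..b}" "dist y x < \<delta>" for y
    using \<delta>(2)[of "{(x, y)}"] \<delta>(2)[of "{(y, x)}"] x that
    by (cases "x \<le> y") (auto simp: dist_real_def abs_minus_commute)
  then show "\<exists>d>0. \<forall>x'\<in>{a..b}. dist x' x < d \<longrightarrow> dist (f x') (f x) < \<epsilon>"
    using \<delta>(1) by blast
qed

lemma Lipschitz_imp_absolutely_continuous_on: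
  fixes f :: "real \<Rightarrow> real"
  assumes "\<And>x y. a \<le> x \<Longrightarrow> x \<le> y \<Longrightarrow> y \<le> b \<Longrightarrow> \<bar>f y - f x\<bar> \<le> C * (y - x)"
  shows "absolutely_continuous_on a b f"
  unfolding absolutely_continuous_on_def
proof (intro allI impI)
  fix \<epsilon> :: real assume \<epsilon>: "\<epsilon> > 0"
  define \<delta> where "\<delta> = \<epsilon> / (\<bar>C\<bar> + 1)"
  show "\<exists>\<delta>>0. \<forall>I. finite I \<longrightarrow> (\<forall>(x, y)\<in>I. a \<le> x \<and> x \<le> y \<and> y \<le> b) \<longrightarrow>
        pairwise (\<lambda>(x, y) (x', y'). {x<..<y} \<inter> {x'<..<y'} = {}) I \<longrightarrow>
        (\<Sum>(x, y)\<in>I. y - x) < \<delta> \<longrightarrow> (\<Sum>(x, y)\<in>I. \<bar>f y - f x\<bar>) < \<epsilon>"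
  proof (intro exI[of _ \<delta>] conjI allI impI)
    fix I assume I: "\<forall>(x, y)\<in>I. a \<le> x \<and> x \<le> y \<and> y \<le> b" "(\<Sum>(x, y)\<in>I. y - x) < \<delta>"
    have "(\<Sum>(x, y)\<in>I. \<bar>f y - f x\<bar>) \<le> (\<Sum>(x, y)\<in>I. (\<bar>C\<bar> + 1) * (y - x))"
    proof (rule sum_mono, clarify)
      fix x y assume "(x, y) \<in> I"
      then have *: "a \<le> x" "x \<le> y" "y \<le> b" using I(1) by auto
      then have "\<bar>f y - f x\<bar> \<le> C * (y - x)" by (rule assms)
      also have "\<dots> \<le> (\<bar>C\<bar> + 1) * (y - x)" using * by (intro mult_right_mono) auto
      finally show "\<bar>f y - f x\<bar> \<le> (\<bar>C\<bar> + 1) * (y - x)" .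
    qed
    also have "\<dots> = (\<bar>C\<bar> + 1) * (\<Sum>(x, y)\<in>I. y - x)"
      by (simp add: sum_distrib_left case_prod_unfold)
    also have "\<dots> < (\<bar>C\<bar> + 1) * \<delta>" using I(2) by (intro mult_strict_left_mono) auto
    also have "\<dots> = \<epsilon>" by (simp add: \<delta>_def)
    finally show "(\<Sum>(x, y)\<in>I. \<bar>f y - f x\<bar>) < \<epsilon>" .
  qed (use \<epsilon> in \<open>simp add: \<delta>_def\<close>)
qed

section \<open>Integration over a bounded interval\<close>

abbreviation Leb :: "real \<Rightarrow> real measure" where
  "Leb T \<equiv> lebesgue_on {0..T}"

lemma finite_measure_Leb: "finite_measure (Leb T)"
  by (rule finite_measure_lebesgue_on) auto

lemma borel_measurable_Leb:
  "f \<in> borel_measurable borel \<Longrightarrow> f \<in> borel_measurable (Leb T)"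
  by (intro measurable_restrict_space1 measurable_completion) simp

lemma borel_measurable_Leb_pair:
  assumes "f \<in> borel_measurable (borel \<Otimes>\<^sub>M borel)"
  shows "f \<in> borel_measurable (Leb T \<Otimes>\<^sub>M Leb T)"
proof -
  have [measurable]: "(\<lambda>x. x) \<in> borel_measurable (Leb T)"
    by (rule borel_measurable_Leb) simp
  have "(\<lambda>p. (fst p, snd p)) \<in> Leb T \<Otimes>\<^sub>M Leb T \<rightarrow>\<^sub>M borel \<Otimes>\<^sub>M borel"
    by (intro measurable_Pair measurable_compose[OF measurable_fst] measurable_compose[OF measurable_snd]) auto
  from measurable_compose[OF this assms] show ?thesis by simp
qed

lemma integrable_bounded_mult:
  fixes k h :: "'a \<Rightarrow> real"
  assumes "integrable M h" "k \<in> borel_measurable M" "\<And>x. x \<in> space M \<Longrightarrow> \<bar>k x\<bar> \<le> C"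
  shows "integrable M (\<lambda>x. k x * h x)"
proof (rule Bochner_Integration.integrable_bound)
  show "integrable M (\<lambda>x. C * \<bar>h x\<bar>)" using assms(1) by auto
  show "(\<lambda>x. k x * h x) \<in> borel_measurable M" using assms by auto
  show "AE x in M. norm (k x * h x) \<le> norm (C * \<bar>h x\<bar>)"
  proof (rule AE_I2)
    fix x assume "x \<in> space M"
    then have "\<bar>k x\<bar> \<le> \<bar>C\<bar>" using assms(3)[of x] by linarith
    then have "\<bar>k x\<bar> * \<bar>h x\<bar> \<le> \<bar>C\<bar> * \<bar>h x\<bar>" by (rule mult_right_mono) simp
    then show "norm (k x * h x) \<le> norm (C * \<bar>h x\<bar>)" by (simp add: abs_mult)
  qed
qed

text \<open>Both the indefinite integral and the solution operator below are integral operators with bounded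
  kernels; tested against an integrable function, such an operator passes to its transpose.\<close>

lemma
  fixes K :: "'a \<Rightarrow> 'a \<Rightarrow> real"
  assumes M: "sigma_finite_measure M"
    and K[measurable]: "(\<lambda>(t, s). K t s) \<in> borel_measurable (M \<Otimes>\<^sub>M M)"
    and C: "\<And>t s. t \<in> space M \<Longrightarrow> s \<in> space M \<Longrightarrow> \<bar>K t s\<bar> \<le> C"
    and u: "integrable M u" and h: "integrable M h"
  shows kernel_integrable: "integrable M (\<lambda>t. u t * (\<integral>s. K t s * h s \<partial>M))"
    and kernel_swap: "(\<integral>t. u t * (\<integral>s. K t s * h s \<partial>M) \<partial>M) = (\<integral>s. h s * (\<integral>t. K t s * u t \<partial>M) \<partial>M)"
proof -
  interpret sigma_finite_measure M by fact
  interpret pair_sigma_finite M M ..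
  have [measurable]: "u \<in> borel_measurable M" "h \<in> borel_measurable M" using u h by auto
  have "integrable (M \<Otimes>\<^sub>M M) (\<lambda>p. u (fst p) * h (snd p))"
  proof (rule Fubini_integrable)
    show "integrable M (\<lambda>x. \<integral>y. norm (u (fst (x, y)) * h (snd (x, y))) \<partial>M)"
      using u by (simp add: abs_mult)
    show "AE x in M. integrable M (\<lambda>y. u (fst (x, y)) * h (snd (x, y)))"
      using h by simp
  qed measurable
  then have "integrable (M \<Otimes>\<^sub>M M) (\<lambda>p. (case p of (t, s) \<Rightarrow> K t s) * (u (fst p) * h (snd p)))"
    by (rule integrable_bounded_mult[where C = C]) (use C in \<open>auto simp: space_pair_measure\<close>)
  then have int: "integrable (M \<Otimes>\<^sub>M M) (\<lambda>(t, s). u t * (K t s * h s))"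
    by (simp add: case_prod_unfold mult_ac)
  from integrable_fst'[OF int] show "integrable M (\<lambda>t. u t * (\<integral>s. K t s * h s \<partial>M))"
    by simp
  have "(\<integral>t. \<integral>s. u t * (K t s * h s) \<partial>M \<partial>M) = (\<integral>s. \<integral>t. u t * (K t s * h s) \<partial>M \<partial>M)"
    using Fubini_integral[OF int] by simp
  also have "\<dots> = (\<integral>s. \<integral>t. h s * (K t s * u t) \<partial>M \<partial>M)"
    by (simp add: mult_ac)
  finally show "(\<integral>t. u t * (\<integral>s. K t s * h s \<partial>M) \<partial>M) = (\<integral>s. h s * (\<integral>t. K t s * u t \<partial>M) \<partial>M)"
    by simp
qed

lemma integrable_Leb_bounded:
  fixes k :: "real \<Rightarrow> real"
  assumes "k \<in> borel_measurable (Leb T)" "\<And>x. 0 \<le> x \<Longrightarrow> x \<le> T \<Longrightarrow> \<bar>k x\<bar> \<le> C"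
  shows "integrable (Leb T) k"
proof -
  interpret finite_measure "Leb T" by (rule finite_measure_Leb)
  show ?thesis using assms by (intro integrable_const_bound[where B = C]) auto
qed

text \<open>The integrand is written with a conditional instead of an indicator because the kernels below
  are cut off in this way at the diagonal.\<close>

lemma integral_Leb_FTC:
  fixes F f :: "real \<Rightarrow> real"
  assumes F: "\<And>x. (F has_real_derivative f x) (at x)" and f: "continuous_on UNIV f"
    and ac: "0 \<le> a" "c \<le> T" "a \<le> c"
  shows "(\<integral>t. (if a \<le> t \<and> t \<le> c then f t else 0) \<partial>Leb T) = F c - F a"
proof -
  have [measurable]: "f \<in> borel_measurable borel"
    using f by (rule borel_measurable_continuous_onI)
  have "(\<integral>t. (if a \<le> t \<and> t \<le> c then f t else 0) \<partial>Leb T) =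
      (\<integral>t. indicator {0..T} t *\<^sub>R (if a \<le> t \<and> t \<le> c then f t else 0) \<partial>lebesgue)"
    by (rule integral_restrict_space) auto
  also have "\<dots> = (\<integral>t. f t * indicator {a..c} t \<partial>lebesgue)"
    using ac by (intro Bochner_Integration.integral_cong) (auto simp: indicator_def)
  also have "\<dots> = (\<integral>t. f t * indicator {a..c} t \<partial>lborel)"
    by (rule integral_completion) measurable
  also have "\<dots> = F c - F a"
    using ac F f by (intro integral_FTC_Icc_real) (auto simp: continuous_on_eq_continuous_at)
  finally show ?thesis .
qed

lemma integral_Leb_le:
  fixes h :: "real \<Rightarrow> real"
  assumes "integrable (Leb T) h" "0 \<le> x" "x \<le> T"
  shows "(\<integral>t. (if t \<le> x then h t else 0) \<partial>Leb T) = integral {0..x} h"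
proof -
  have "integrable (Leb T) (\<lambda>t. indicator {..x} t * h t)"
    by (rule integrable_bounded_mult[OF assms(1), where C = 1])
       (auto intro!: borel_measurable_Leb simp: indicator_def)
  then have int: "integrable (Leb T) (\<lambda>t. if t \<le> x then h t else 0)"
    by (rule back_subst[of "integrable (Leb T)"]) (auto simp: indicator_def)
  have "(\<integral>t. (if t \<le> x then h t else 0) \<partial>Leb T) = integral {0..T} (\<lambda>t. if t \<in> {..x} then h t else 0)"
    using lebesgue_integral_eq_integral[OF int] by simp
  also have "\<dots> = integral ({0..T} \<inter> {..x}) h" by (metis Int_commute integral_restrict_Int)
  also have "{0..T} \<inter> {..x} = {0..x}" using assms by auto
  finally show ?thesis .
qed

lemma integral_Leb_ge:
  fixes h :: "real \<Rightarrow> real"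
  assumes "integrable (Leb T) h" "0 \<le> x" "x \<le> T"
  shows "(\<integral>t. (if x \<le> t then h t else 0) \<partial>Leb T) = integral {x..T} h"
proof -
  have "integrable (Leb T) (\<lambda>t. indicator {x..} t * h t)"
    by (rule integrable_bounded_mult[OF assms(1), where C = 1])
       (auto intro!: borel_measurable_Leb simp: indicator_def)
  then have int: "integrable (Leb T) (\<lambda>t. if x \<le> t then h t else 0)"
    by (rule back_subst[of "integrable (Leb T)"]) (auto simp: indicator_def)
  have "(\<integral>t. (if x \<le> t then h t else 0) \<partial>Leb T) = integral {0..T} (\<lambda>t. if t \<in> {x..} then h t else 0)"
    using lebesgue_integral_eq_integral[OF int] by simp
  also have "\<dots> = integral ({0..T} \<inter> {x..}) h" by (metis Int_commute integral_restrict_Int)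
  also have "{0..T} \<inter> {x..} = {x..T}" using assms by auto
  finally show ?thesis .
qed

lemma continuous_on_Icc_bounded:
  fixes f :: "real \<Rightarrow> real"
  assumes "continuous_on {a..b} f"
  obtains C where "\<And>x. a \<le> x \<Longrightarrow> x \<le> b \<Longrightarrow> \<bar>f x\<bar> \<le> C"
proof -
  have "compact (f ` {a..b})" using assms by (rule compact_continuous_image) simp
  then obtain C where "\<forall>x\<in>f ` {a..b}. norm x \<le> C"
    using compact_imp_bounded bounded_iff by blast
  then show ?thesis by (intro that[of C]) auto
qed

lemma continuous_on_Leb_measurable:
  fixes f :: "real \<Rightarrow> real"
  assumes "continuous_on {0..T} f"
  shows "f \<in> borel_measurable (Leb T)"
  using assms by (rule continuous_imp_measurable_on_sets_lebesgue) auto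

lemma integrable_square_diff:
  fixes f g :: "'a \<Rightarrow> real"
  assumes [measurable]: "f \<in> borel_measurable M" "g \<in> borel_measurable M"
    and "integrable M (\<lambda>x. (f x)\<^sup>2)" "integrable M (\<lambda>x. (g x)\<^sup>2)"
  shows "integrable M (\<lambda>x. (f x - g x)\<^sup>2)"
proof (rule Bochner_Integration.integrable_bound)
  show "integrable M (\<lambda>x. 2 * (f x)\<^sup>2 + 2 * (g x)\<^sup>2)" using assms(3,4) by simp
  have "(x - y)\<^sup>2 \<le> 2 * x\<^sup>2 + 2 * y\<^sup>2" for x y :: real
    using zero_le_power2[of "x + y"] by (simp add: power2_eq_square algebra_simps)
  then show "AE x in M. norm ((f x - g x)\<^sup>2) \<le> norm (2 * (f x)\<^sup>2 + 2 * (g x)\<^sup>2)"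
    by (intro AE_I2) simp
qed simp

lemma continuous_square_integrable:
  fixes f :: "real \<Rightarrow> real"
  assumes "continuous_on {0..T} f"
  shows "integrable (Leb T) (\<lambda>t. (f t)\<^sup>2)"
proof -
  have "continuous_on {0..T} (\<lambda>t. (f t)\<^sup>2)" using assms by (intro continuous_intros)
  moreover from continuous_on_Icc_bounded[OF this] obtain C where
    "\<And>x. 0 \<le> x \<Longrightarrow> x \<le> T \<Longrightarrow> \<bar>(f x)\<^sup>2\<bar> \<le> C" by blast
  ultimately show ?thesis
    by (intro integrable_Leb_bounded[where C = C] continuous_on_Leb_measurable)
qed

lemma continuous_mult_integrable:
  fixes f h :: "real \<Rightarrow> real"
  assumes "continuous_on {0..T} f" "integrable (Leb T) h"
  shows "integrable (Leb T) (\<lambda>t. f t * h t)"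
proof -
  from continuous_on_Icc_bounded[OF assms(1)] obtain C where
    "\<And>x. 0 \<le> x \<Longrightarrow> x \<le> T \<Longrightarrow> \<bar>f x\<bar> \<le> C" by blast
  then show ?thesis
    by (intro integrable_bounded_mult[where C = C] continuous_on_Leb_measurable assms) auto
qed

section \<open>The Sobolev class\<close>

text \<open>The derivative in \<open>W21\<close> is only known to exist almost everywhere, so its measurability also comes
  from the fundamental theorem, as that of any Henstock-Kurzweil integrable function.  The last part
  integrates from \<open>x\<close> to the right end because this is what the transposed kernel in the integration
  by parts asks for.\<close>

lemma
  assumes f: "f \<in> W21 T" and T: "T > 0"
  shows W21_continuous: "continuous_on {0..T} f"
    and W21_measurable: "deriv f \<in> borel_measurable (Leb T)"
    and W21_square_integrable: "integrable (Leb T) (\<lambda>t. (deriv f t)\<^sup>2)"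
    and W21_integrable: "integrable (Leb T) (deriv f)"
    and W21_FTC: "\<And>x. 0 \<le> x \<Longrightarrow> x \<le> T \<Longrightarrow> (\<integral>t. (if x \<le> t then deriv f t else 0) \<partial>Leb T) = f T - f x"
proof -
  have ac: "absolutely_continuous_on 0 T f"
    and diff: "AE s in lebesgue. s \<in> {0<..<T} \<longrightarrow> f differentiable (at s)"
    and sq: "set_integrable lebesgue {0..T} (\<lambda>s. (deriv f s)\<^sup>2)"
    using f by (auto simp: W21_def)
  show "continuous_on {0..T} f" by (rule absolutely_continuous_on_imp_continuous_on) fact
  have "(deriv f has_integral (f T - f 0)) {0..T}"
    using T by (intro absolutely_continuous_on_FTC ac diff) auto
  then show m: "deriv f \<in> borel_measurable (Leb T)"
    by (intro integrable_imp_measurable) (auto simp: integrable_on_def)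
  show sq': "integrable (Leb T) (\<lambda>t. (deriv f t)\<^sup>2)"
    using sq by (subst integrable_restrict_space) (auto simp: set_integrable_def)
  show int: "integrable (Leb T) (deriv f)"
    by (rule finite_measure.square_integrable_imp_integrable[OF finite_measure_Leb m sq'])
  fix x assume x: "0 \<le> x" "x \<le> T"
  have "(deriv f has_integral (f T - f x)) {x..T}"
  proof (rule absolutely_continuous_on_FTC)
    show "absolutely_continuous_on x T f" using ac by (rule absolutely_continuous_on_subset) (use x in auto)
    show "AE s in lebesgue. s \<in> {x<..<T} \<longrightarrow> f differentiable (at s)"
      using diff by eventually_elim (use x in auto)
  qed fact
  then show "(\<integral>t. (if x \<le> t then deriv f t else 0) \<partial>Leb T) = f T - f x"
    by (simp add: integral_Leb_ge[OF int x] integral_unique)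
qed

text \<open>With \<open>q t = \<integral>\<^sub>0\<^sup>t h\<close> this is \<open>\<integral> f' q = - \<integral> f q'\<close> for \<open>q 0 = q T = 0\<close>.  Swapping the order of
  integration in the double integral of \<open>f' t * h s\<close> over \<open>s \<le> t\<close> turns the inner integral into
  \<open>f T - f s\<close>, and the term with \<open>f T\<close> vanishes because \<open>h\<close> has mean zero.\<close>

lemma W21_integration_by_parts:
  assumes f: "f \<in> W21 T" and T: "T > 0"
    and h: "integrable (Leb T) h" "(\<integral>t. h t \<partial>Leb T) = 0"
  shows "(\<integral>t. deriv f t * (\<integral>s. (if s \<le> t then h s else 0) \<partial>Leb T) \<partial>Leb T) = - (\<integral>t. f t * h t \<partial>Leb T)"
proof -
  interpret finite_measure "Leb T" by (rule finite_measure_Leb)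
  let ?K = "\<lambda>t s. if s \<le> t then 1 else (0::real)"
  have eq: "(if s \<le> t then h s else 0) = ?K t s * h s" for t s by simp
  have "(\<integral>t. deriv f t * (\<integral>s. (if s \<le> t then h s else 0) \<partial>Leb T) \<partial>Leb T) =
      (\<integral>s. h s * (\<integral>t. ?K t s * deriv f t \<partial>Leb T) \<partial>Leb T)"
    unfolding eq
    by (rule kernel_swap[where C = 1])
       (use W21_integrable[OF f T] h in \<open>auto intro!: borel_measurable_Leb_pair sigma_finite_measure_axioms\<close>)
  also have "\<dots> = (\<integral>s. f T * h s - f s * h s \<partial>Leb T)"
  proof (rule Bochner_Integration.integral_cong[OF refl])
    fix s assume "s \<in> space (Leb T)"
    then have "(\<integral>t. (if s \<le> t then deriv f t else 0) \<partial>Leb T) = f T - f s"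
      by (intro W21_FTC[OF f T]) auto
    moreover have "?K t s * deriv f t = (if s \<le> t then deriv f t else 0)" for t by simp
    ultimately show "h s * (\<integral>t. ?K t s * deriv f t \<partial>Leb T) = f T * h s - f s * h s"
      by (simp only:) (simp add: algebra_simps)
  qed
  also have "\<dots> = f T * (\<integral>s. h s \<partial>Leb T) - (\<integral>s. f s * h s \<partial>Leb T)"
  proof -
    have "integrable (Leb T) (\<lambda>s. f s * h s)"
      by (rule continuous_mult_integrable[OF W21_continuous[OF f T] h(1)])
    then show ?thesis using h(1) by simp
  qed
  finally show ?thesis using h(2) by simp
qed

section \<open>The Neumann Green function\<close>

text \<open>The Green function of \<open>f - f'' = b\<close> on \<open>[0, T]\<close> with \<open>f' 0 = f' T = 0\<close>, written as a
  homogeneous solution in \<open>t\<close> that is flat at \<open>0\<close>, minus the Volterra kernel of \<open>f'' - f\<close>.  In this form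
  integrals in \<open>t\<close> reduce to those of \<open>cosh\<close> and \<open>sinh\<close>; the symmetric form is \<open>green_eq\<close>.\<close>

definition green :: "real \<Rightarrow> real \<Rightarrow> real \<Rightarrow> real" where
  "green T t s = cosh t * cosh (T - s) / sinh T - (if s \<le> t then sinh (t - s) else 0)"

text \<open>The derivative of \<open>green T t s\<close> in \<open>t\<close>, with its value on the diagonal fixed by \<open>s \<le> t\<close>.\<close>

definition green_deriv :: "real \<Rightarrow> real \<Rightarrow> real \<Rightarrow> real" where
  "green_deriv T t s = sinh t * cosh (T - s) / sinh T - (if s \<le> t then cosh (t - s) else 0)"

lemma cosh_measurable [measurable]: "(cosh :: real \<Rightarrow> real) \<in> borel_measurable borel"
  and sinh_measurable [measurable]: "(sinh :: real \<Rightarrow> real) \<in> borel_measurable borel"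
  by (auto intro!: borel_measurable_continuous_onI continuous_intros)

lemma green_measurable [measurable]: "(\<lambda>(t, s). green T t s) \<in> borel_measurable (borel \<Otimes>\<^sub>M borel)"
  and green_deriv_measurable [measurable]: "(\<lambda>(t, s). green_deriv T t s) \<in> borel_measurable (borel \<Otimes>\<^sub>M borel)"
  unfolding green_def green_deriv_def by measurable

lemma green_eq:
  assumes "T > 0"
  shows "green T t s = cosh (min t s) * cosh (T - max t s) / sinh T"
proof (cases "s \<le> t")
  case True
  have "cosh t * cosh (T - s) - sinh (t - s) * sinh T = cosh s * cosh (T - t)"
    using cosh_square_eq[of t] cosh_square_eq[of s]
    by (simp add: cosh_diff sinh_diff power2_eq_square algebra_simps)
  moreover have "sinh T > 0" using assms by simp
  ultimately have "cosh t * cosh (T - s) / sinh T - sinh (t - s) = cosh s * cosh (T - t) / sinh T"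
    by (simp add: field_simps)
  then show ?thesis using True by (simp add: green_def min_def max_def)
qed (simp add: green_def min_def max_def)

lemma green_commute: "T > 0 \<Longrightarrow> green T t s = green T s t"
  by (simp add: green_eq min.commute max.commute)

lemma green_ge: "T > 0 \<Longrightarrow> green T t s \<ge> 1 / sinh T"
proof -
  assume "T > 0"
  have "1 * 1 \<le> cosh (min t s) * cosh (T - max t s)"
    by (intro mult_mono cosh_real_ge_1) (use cosh_real_ge_1[of "min t s"] in linarith, simp)
  then show ?thesis using \<open>T > 0\<close> by (simp add: green_eq divide_right_mono)
qed

lemma green_nonneg: "T > 0 \<Longrightarrow> green T t s \<ge> 0"
  using green_ge[of T t s] by (smt (verit) divide_nonneg_pos sinh_real_pos_iff)

lemma green_bound:
  assumes "T > 0" "0 \<le> t" "t \<le> T" "0 \<le> s" "s \<le> T"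
  shows "\<bar>green T t s\<bar> \<le> cosh T * cosh T / sinh T + cosh T"
    and "\<bar>green_deriv T t s\<bar> \<le> cosh T * cosh T / sinh T + cosh T"
proof -
  have c: "cosh x \<le> cosh T" "\<bar>sinh x\<bar> \<le> cosh T" if "\<bar>x\<bar> \<le> T" for x
  proof -
    have "cosh x = cosh \<bar>x\<bar>" by simp
    also have "\<dots> \<le> cosh T" using that assms(1) by (subst cosh_real_nonneg_le_iff) auto
    finally show *: "cosh x \<le> cosh T" .
    have "\<bar>sinh x\<bar> \<le> cosh x" by (auto simp: abs_le_iff sinh_def cosh_def field_simps)
    then show "\<bar>sinh x\<bar> \<le> cosh T" using * by simp
  qed
  have pos: "sinh T > 0" "cosh T > 0" using assms by auto
  have b: "\<bar>cosh t * cosh (T - s) / sinh T\<bar> \<le> cosh T * cosh T / sinh T"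
    "\<bar>sinh t * cosh (T - s) / sinh T\<bar> \<le> cosh T * cosh T / sinh T"
    using pos assms c(1)[of "T - s"] c[of t]
    by (auto simp: abs_mult intro!: divide_right_mono mult_mono)
  have "\<bar>if s \<le> t then sinh (t - s) else 0\<bar> \<le> cosh T" "\<bar>if s \<le> t then cosh (t - s) else 0\<bar> \<le> cosh T"
    using pos assms c[of "t - s"] by auto
  with b show "\<bar>green T t s\<bar> \<le> cosh T * cosh T / sinh T + cosh T"
    "\<bar>green_deriv T t s\<bar> \<le> cosh T * cosh T / sinh T + cosh T"
    unfolding green_def green_deriv_def by linarith+
qed

text \<open>The integrated form of \<open>\<partial>\<^sub>t G = G'\<close> and \<open>\<partial>\<^sub>t G' = G - \<delta>\<^sub>s\<close>; the unit jump of \<open>G'\<close> across the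
  diagonal appears as the extra term.\<close>

lemma
  assumes T: "T > 0" and x: "0 \<le> x" "x \<le> T" and s: "0 \<le> s" "s \<le> T"
  shows integral_green: "(\<integral>t. (if t \<le> x then green T t s else 0) \<partial>Leb T) = green_deriv T x s + (if s \<le> x then 1 else 0)"
    and integral_green_deriv: "(\<integral>t. (if t \<le> x then green_deriv T t s else 0) \<partial>Leb T) = green T x s - green T 0 s"
proof -
  have comb: "(\<integral>t. c * (if 0 \<le> t \<and> t \<le> x then f t else 0) - (if s \<le> t \<and> t \<le> x then g (t - s) else 0) \<partial>Leb T)
      = c * (F x - F 0) - (if s \<le> x then G (x - s) - G 0 else 0)"
    if F: "\<And>x. (F has_real_derivative f x) (at x)" and f: "continuous_on UNIV f"
      and G: "\<And>x. (G has_real_derivative g x) (at x)" and g: "continuous_on UNIV g" for F f G g :: "real \<Rightarrow> real" and c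
  proof -
    have [measurable]: "f \<in> borel_measurable borel" "g \<in> borel_measurable borel"
      using f g by (auto intro: borel_measurable_continuous_onI)
    obtain C1 where C1: "\<And>t. 0 \<le> t \<Longrightarrow> t \<le> T \<Longrightarrow> \<bar>f t\<bar> \<le> C1"
      using continuous_on_Icc_bounded[OF continuous_on_subset[OF f subset_UNIV]] by blast
    obtain C2 where C2: "\<And>t. 0 \<le> t \<Longrightarrow> t \<le> T \<Longrightarrow> \<bar>g t\<bar> \<le> C2"
      using continuous_on_Icc_bounded[OF continuous_on_subset[OF g subset_UNIV]] by blast
    have i1: "integrable (Leb T) (\<lambda>t. if 0 \<le> t \<and> t \<le> x then f t else 0)"
    proof (rule integrable_Leb_bounded[where C = "\<bar>C1\<bar>"])
      fix t assume "0 \<le> t" "t \<le> T"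
      then show "\<bar>if 0 \<le> t \<and> t \<le> x then f t else 0\<bar> \<le> \<bar>C1\<bar>" using C1[of t] by auto
    qed (rule borel_measurable_Leb, measurable)
    have i2: "integrable (Leb T) (\<lambda>t. if s \<le> t \<and> t \<le> x then g (t - s) else 0)"
    proof (rule integrable_Leb_bounded[where C = "\<bar>C2\<bar>"])
      fix t assume "0 \<le> t" "t \<le> T"
      then show "\<bar>if s \<le> t \<and> t \<le> x then g (t - s) else 0\<bar> \<le> \<bar>C2\<bar>" using C2[of "t - s"] s by auto
    qed (rule borel_measurable_Leb, measurable)
    have "(\<integral>t. (if s \<le> t \<and> t \<le> x then g (t - s) else 0) \<partial>Leb T) = (if s \<le> x then G (x - s) - G 0 else 0)"
    proof (cases "s \<le> x")
      case True
      have "((\<lambda>t. G (t - s)) has_real_derivative g (t - s)) (at t)" for t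
        using DERIV_shift[of G "g (t - s)" t "- s"] G[of "t - s"] by simp
      moreover have "continuous_on UNIV (\<lambda>t. g (t - s))"
        by (intro continuous_on_compose2[OF g] continuous_intros) auto
      ultimately have "(\<integral>t. (if s \<le> t \<and> t \<le> x then g (t - s) else 0) \<partial>Leb T) = G (x - s) - G (s - s)"
        using True s x by (intro integral_Leb_FTC[where F = "\<lambda>t. G (t - s)"]) auto
      then show ?thesis using True by simp
    next
      case False
      then have "(if s \<le> t \<and> t \<le> x then g (t - s) else 0) = 0" for t by auto
      then show ?thesis using False by simp
    qed
    moreover have "(\<integral>t. (if 0 \<le> t \<and> t \<le> x then f t else 0) \<partial>Leb T) = F x - F 0"
      using x F f by (intro integral_Leb_FTC) auto
    ultimately show ?thesis using i1 i2 by simp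
  qed
  have T0: "sinh T \<noteq> 0" using T by simp
  have "(\<integral>t. (if t \<le> x then green T t s else 0) \<partial>Leb T) =
    (\<integral>t. cosh (T - s) / sinh T * (if 0 \<le> t \<and> t \<le> x then cosh t else 0)
        - (if s \<le> t \<and> t \<le> x then sinh (t - s) else 0) \<partial>Leb T)"
    by (intro Bochner_Integration.integral_cong) (auto simp: green_def)
  also have "\<dots> = cosh (T - s) / sinh T * (sinh x - sinh 0) - (if s \<le> x then cosh (x - s) - cosh 0 else 0)"
    by (rule comb) (auto intro!: derivative_eq_intros continuous_intros)
  finally show "(\<integral>t. (if t \<le> x then green T t s else 0) \<partial>Leb T) = green_deriv T x s + (if s \<le> x then 1 else 0)"
    by (simp add: green_deriv_def)
  have "(\<integral>t. (if t \<le> x then green_deriv T t s else 0) \<partial>Leb T) =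
    (\<integral>t. cosh (T - s) / sinh T * (if 0 \<le> t \<and> t \<le> x then sinh t else 0)
        - (if s \<le> t \<and> t \<le> x then cosh (t - s) else 0) \<partial>Leb T)"
    by (intro Bochner_Integration.integral_cong) (auto simp: green_deriv_def)
  also have "\<dots> = cosh (T - s) / sinh T * (cosh x - cosh 0) - (if s \<le> x then sinh (x - s) - sinh 0 else 0)"
    by (rule comb) (auto intro!: derivative_eq_intros continuous_intros)
  finally show "(\<integral>t. (if t \<le> x then green_deriv T t s else 0) \<partial>Leb T) = green T x s - green T 0 s"
  proof -
    have "green T 0 s = cosh (T - s) / sinh T" using s by (simp add: green_def)
    then show "a = green T x s - green T 0 s"
      if "a = cosh (T - s) / sinh T * (cosh x - cosh 0) - (if s \<le> x then sinh (x - s) - sinh 0 else 0)" for a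
      unfolding that by (simp add: green_def[of T x] right_diff_distrib left_diff_distrib diff_divide_distrib mult.commute)
  qed
qed

text \<open>The Neumann condition at the right end.\<close>

lemma green_deriv_end: "T > 0 \<Longrightarrow> s \<le> T \<Longrightarrow> green_deriv T T s = 0"
  by (simp add: green_deriv_def)

text \<open>Constants solve \<open>f - f'' = b\<close> with \<open>b = f\<close>; here the normalization is read off from the integrated
  equation at the right end, where the derivative kernel vanishes.\<close>

lemma integral_green_1:
  assumes "T > 0" "0 \<le> s" "s \<le> T"
  shows "(\<integral>t. green T t s \<partial>Leb T) = 1" "(\<integral>t. green T s t \<partial>Leb T) = 1"
proof -
  have "(\<integral>t. green T t s \<partial>Leb T) = (\<integral>t. (if t \<le> T then green T t s else 0) \<partial>Leb T)"
    by (intro Bochner_Integration.integral_cong) auto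
  also have "\<dots> = 1" using integral_green[of T T s] assms by (simp add: green_deriv_end)
  finally show "(\<integral>t. green T t s \<partial>Leb T) = 1" .
  then show "(\<integral>t. green T s t \<partial>Leb T) = 1" using assms by (simp add: green_commute[of T s])
qed

section \<open>The solution operator of the Euler-Lagrange equation\<close>

definition green_op :: "real \<Rightarrow> (real \<Rightarrow> real) \<Rightarrow> real \<Rightarrow> real" where
  "green_op T b t = (\<integral>s. green T t s * b s \<partial>Leb T)"

definition green_deriv_op :: "real \<Rightarrow> (real \<Rightarrow> real) \<Rightarrow> real \<Rightarrow> real" where
  "green_deriv_op T b t = (\<integral>s. green_deriv T t s * b s \<partial>Leb T)"

lemma sigma_finite_Leb: "sigma_finite_measure (Leb T)"
  using finite_measure_Leb[of T] by (simp add: finite_measure_def)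

lemma green_swap:
  assumes T: "T > 0" and u: "integrable (Leb T) u" and b: "integrable (Leb T) b"
  shows "integrable (Leb T) (\<lambda>t. u t * green_op T b t)"
    and "integrable (Leb T) (\<lambda>t. u t * green_deriv_op T b t)"
    and "(\<integral>t. u t * green_op T b t \<partial>Leb T) = (\<integral>s. b s * (\<integral>t. green T t s * u t \<partial>Leb T) \<partial>Leb T)"
    and "(\<integral>t. u t * green_deriv_op T b t \<partial>Leb T) = (\<integral>s. b s * (\<integral>t. green_deriv T t s * u t \<partial>Leb T) \<partial>Leb T)"
  unfolding green_op_def green_deriv_op_def
  by (rule kernel_integrable kernel_swap sigma_finite_Leb borel_measurable_Leb_pair green_measurable green_deriv_measurable
      | rule u b | (rule green_bound[OF T]; simp))+

text \<open>Integrated form of \<open>f' = q\<close> and \<open>q' = f - b\<close> for \<open>f = green_op T b\<close> and \<open>q = green_deriv_op T b\<close>,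
  obtained from the kernel identities by testing against the indicator of \<open>[0, x]\<close>.\<close>

lemma green_op_integrals:
  assumes T: "T > 0" and b: "integrable (Leb T) b" and x: "0 \<le> x" "x \<le> T"
  shows "(\<integral>t. (if t \<le> x then green_deriv_op T b t else 0) \<partial>Leb T) = green_op T b x - green_op T b 0"
    and "(\<integral>t. (if t \<le> x then green_op T b t - b t else 0) \<partial>Leb T) = green_deriv_op T b x"
proof -
  let ?u = "\<lambda>t. if t \<le> x then 1 else 0 :: real"
  have u: "integrable (Leb T) ?u"
    by (rule integrable_Leb_bounded[where C = 1]) (auto intro: borel_measurable_Leb)
  have ub: "integrable (Leb T) (\<lambda>s. ?u s * b s)"
    by (rule integrable_bounded_mult[OF b, where C = 1]) (auto intro: borel_measurable_Leb)
  have g: "integrable (Leb T) (\<lambda>s. green T y s * b s)" "integrable (Leb T) (\<lambda>s. green_deriv T y s * b s)" if "0 \<le> y" "y \<le> T" for y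
  proof -
    have [measurable]: "green T y \<in> borel_measurable borel" "green_deriv T y \<in> borel_measurable borel"
      unfolding green_def[abs_def] green_deriv_def[abs_def] by measurable
    show "integrable (Leb T) (\<lambda>s. green T y s * b s)" "integrable (Leb T) (\<lambda>s. green_deriv T y s * b s)"
      by (rule integrable_bounded_mult[OF b, where C = "cosh T * cosh T / sinh T + cosh T"];
          use green_bound[OF T that] in \<open>auto intro: borel_measurable_Leb\<close>)+
  qed
  have eq: "k * ?u t = (if t \<le> x then k else 0)" "?u t * k = (if t \<le> x then k else 0)" for k t by auto
  have "(\<integral>t. (if t \<le> x then green_deriv_op T b t else 0) \<partial>Leb T)
      = (\<integral>s. b s * (\<integral>t. (if t \<le> x then green_deriv T t s else 0) \<partial>Leb T) \<partial>Leb T)"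
    using green_swap(4)[OF T u b] unfolding eq .
  also have "\<dots> = (\<integral>s. green T x s * b s - green T 0 s * b s \<partial>Leb T)"
    using x by (intro Bochner_Integration.integral_cong)
      (auto simp: integral_green_deriv[OF T] algebra_simps)
  also have "\<dots> = green_op T b x - green_op T b 0"
    using g[of x] g[of 0] x by (simp add: green_op_def)
  finally show "(\<integral>t. (if t \<le> x then green_deriv_op T b t else 0) \<partial>Leb T) = green_op T b x - green_op T b 0" .
  have "(\<integral>t. (if t \<le> x then green_op T b t else 0) \<partial>Leb T)
      = (\<integral>s. b s * (\<integral>t. (if t \<le> x then green T t s else 0) \<partial>Leb T) \<partial>Leb T)"
    using green_swap(3)[OF T u b] unfolding eq .
  also have "\<dots> = (\<integral>s. green_deriv T x s * b s + ?u s * b s \<partial>Leb T)"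
    using x by (intro Bochner_Integration.integral_cong)
      (auto simp: integral_green[OF T] algebra_simps)
  also have "\<dots> = green_deriv_op T b x + (\<integral>s. ?u s * b s \<partial>Leb T)"
    using g[of x] ub x by (simp add: green_deriv_op_def)
  finally have *: "(\<integral>t. (if t \<le> x then green_op T b t else 0) \<partial>Leb T) = green_deriv_op T b x + (\<integral>s. ?u s * b s \<partial>Leb T)" .
  have "(\<integral>t. (if t \<le> x then green_op T b t - b t else 0) \<partial>Leb T)
      = (\<integral>t. ?u t * green_op T b t - ?u t * b t \<partial>Leb T)"
    by (intro Bochner_Integration.integral_cong) auto
  also have "\<dots> = (\<integral>t. ?u t * green_op T b t \<partial>Leb T) - (\<integral>t. ?u t * b t \<partial>Leb T)"
    by (rule Bochner_Integration.integral_diff[OF green_swap(1)[OF T u b] ub])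
  also have "\<dots> = green_deriv_op T b x" using * unfolding eq by simp
  finally show "(\<integral>t. (if t \<le> x then green_op T b t - b t else 0) \<partial>Leb T) = green_deriv_op T b x" .
qed

lemma green_op_integrable:
  assumes "T > 0" "integrable (Leb T) b"
  shows "integrable (Leb T) (green_op T b)" "integrable (Leb T) (green_deriv_op T b)"
proof -
  have "integrable (Leb T) (\<lambda>_. 1 :: real)"
    by (rule integrable_Leb_bounded[where C = 1]) auto
  from green_swap(1,2)[OF assms(1) this assms(2)]
  show "integrable (Leb T) (green_op T b)" "integrable (Leb T) (green_deriv_op T b)" by auto
qed

lemma green_deriv_op_end:
  assumes "T > 0"
  shows "green_deriv_op T b T = 0"
proof -
  have "green_deriv_op T b T = (\<integral>s. 0 \<partial>Leb T)"
    unfolding green_deriv_op_def using assms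
    by (intro Bochner_Integration.integral_cong) (auto simp: green_deriv_end)
  then show ?thesis by simp
qed

lemma green_op_residual_integral:
  assumes "T > 0" "integrable (Leb T) b"
  shows "(\<integral>t. green_op T b t - b t \<partial>Leb T) = 0"
proof -
  have "(\<integral>t. green_op T b t - b t \<partial>Leb T) = (\<integral>t. (if t \<le> T then green_op T b t - b t else 0) \<partial>Leb T)"
    by (intro Bochner_Integration.integral_cong) auto
  also have "\<dots> = 0" using green_op_integrals(2)[of T b T] assms by (simp add: green_deriv_op_end)
  finally show ?thesis .
qed

text \<open>The function is an indefinite integral by the equation \<open>q' = f - b\<close>.  Continuity of the derivative
  is what makes the solution differentiable everywhere in the interior, and not only almost
  everywhere.\<close>

lemma green_deriv_op_continuous:
  assumes "T > 0" "integrable (Leb T) b"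
  shows "continuous_on {0..T} (green_deriv_op T b)"
proof -
  have int: "integrable (Leb T) (\<lambda>t. green_op T b t - b t)"
    using green_op_integrable(1)[OF assms] assms(2) by simp
  have "continuous_on {0..T} (\<lambda>x. integral {0..x} (\<lambda>t. green_op T b t - b t))"
    by (intro indefinite_integral_continuous_1 integrable_on_lebesgue_on int) auto
  then show ?thesis
    by (rule continuous_on_eq) (simp add: integral_Leb_le[OF int, symmetric] green_op_integrals(2)[OF assms])
qed

lemma green_op_has_derivative:
  assumes "T > 0" "integrable (Leb T) b" "x \<in> {0..T}"
  shows "(green_op T b has_real_derivative green_deriv_op T b x) (at x within {0..T})"
proof -
  have "((\<lambda>u. integral {0..u} (green_deriv_op T b)) has_real_derivative green_deriv_op T b x) (at x within {0..T})"
    unfolding has_real_derivative_iff_has_vector_derivative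
    by (intro integral_has_vector_derivative green_deriv_op_continuous assms)
  then have "((\<lambda>u. green_op T b 0 + integral {0..u} (green_deriv_op T b)) has_real_derivative green_deriv_op T b x) (at x within {0..T})"
    by (auto intro!: derivative_eq_intros)
  then show ?thesis
  proof (rule has_field_derivative_transform_within[OF _ zero_less_one assms(3)])
    fix y assume "y \<in> {0..T}"
    then show "green_op T b 0 + integral {0..y} (green_deriv_op T b) = green_op T b y"
      using integral_Leb_le[OF green_op_integrable(2)[OF assms(1,2)], of y] green_op_integrals(1)[OF assms(1,2), of y]
      by simp
  qed
qed

lemma deriv_green_op:
  assumes "T > 0" "integrable (Leb T) b" "x \<in> {0<..<T}"
  shows "green_op T b differentiable (at x)" "deriv (green_op T b) x = green_deriv_op T b x"
proof -
  have "(green_op T b has_real_derivative green_deriv_op T b x) (at x)"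
    using green_op_has_derivative[of T b x] assms by (simp add: at_within_Icc_at)
  then show "green_op T b differentiable (at x)" "deriv (green_op T b) x = green_deriv_op T b x"
    by (auto simp: DERIV_imp_deriv real_differentiable_def)
qed

lemma AE_Leb_interior: "AE x in Leb T. x \<in> {0<..<T}"
proof -
  have "AE x in lebesgue. x \<noteq> a" for a :: real
    by (intro AE_completion AE_lborel_singleton)
  from this[of 0] this[of T] have "AE x in lebesgue. x \<in> {0..T} \<longrightarrow> x \<in> {0<..<T}"
    by eventually_elim auto
  then show ?thesis by (subst AE_restrict_space_iff) auto
qed

lemma deriv_green_op_AE:
  assumes "T > 0" "integrable (Leb T) b"
  shows "AE x in Leb T. deriv (green_op T b) x = green_deriv_op T b x"
  using AE_Leb_interior by eventually_elim (rule deriv_green_op(2)[OF assms])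

lemma green_op_W21:
  assumes T: "T > 0" and b: "integrable (Leb T) b"
  shows "green_op T b \<in> W21 T"
proof -
  obtain C where C: "\<And>x. 0 \<le> x \<Longrightarrow> x \<le> T \<Longrightarrow> \<bar>green_deriv_op T b x\<bar> \<le> C"
    using continuous_on_Icc_bounded[OF green_deriv_op_continuous[OF assms]] by blast
  have q[measurable]: "green_deriv_op T b \<in> borel_measurable (Leb T)"
    using green_op_integrable(2)[OF assms] by simp
  have ac: "absolutely_continuous_on 0 T (green_op T b)"
  proof (rule Lipschitz_imp_absolutely_continuous_on)
    fix x y assume "0 \<le> x" "x \<le> y" "y \<le> T"
    then have "norm (green_op T b y - green_op T b x) \<le> C * norm (y - x)"
      using C by (intro field_differentiable_bound[where S = "{0..T}" and f' = "green_deriv_op T b"]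
          green_op_has_derivative assms) auto
    then show "\<bar>green_op T b y - green_op T b x\<bar> \<le> C * (y - x)" using \<open>x \<le> y\<close> by simp
  qed
  have sq: "set_integrable lebesgue {0..T} (\<lambda>s. (deriv (green_op T b) s)\<^sup>2)"
  proof -
    have "integrable (Leb T) (\<lambda>s. (green_deriv_op T b s)\<^sup>2)"
    proof (rule integrable_Leb_bounded[where C = "C\<^sup>2"])
      fix x assume "0 \<le> x" "x \<le> T"
      then show "\<bar>(green_deriv_op T b x)\<^sup>2\<bar> \<le> C\<^sup>2"
        using power_mono[OF C[of x], of 2] by simp
    qed measurable
    moreover have "deriv (green_op T b) \<in> borel_measurable (Leb T)"
      using absolutely_continuous_on_FTC[OF ac] deriv_green_op(1)[OF assms] T
      by (intro integrable_imp_measurable) (auto simp: integrable_on_def)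
    ultimately have "integrable (Leb T) (\<lambda>s. (deriv (green_op T b) s)\<^sup>2)"
      using deriv_green_op_AE[OF assms]
      by (subst integrable_cong_AE[where g = "\<lambda>s. (green_deriv_op T b s)\<^sup>2"]) auto
    then show ?thesis
      by (subst (asm) integrable_restrict_space) (auto simp: set_integrable_def)
  qed
  show ?thesis
    using deriv_green_op(1)[OF assms] ac sq by (auto simp: W21_def)
qed

section \<open>The minimal energy of a path\<close>

lemma energy_eq_Leb: "energy T f b = (\<integral>s. (f s - b s)\<^sup>2 + (deriv f s)\<^sup>2 \<partial>Leb T)"
  unfolding energy_def set_lebesgue_integral_def by (rule integral_restrict_space[symmetric]) auto

text \<open>Let \<open>g\<close> be the solution, \<open>q = g'\<close> and \<open>h = q' = g - b\<close>.  For every competitor \<open>f\<close> the energy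
  exceeds that of \<open>g\<close> by the nonnegative square terms in \<open>f - g\<close> and \<open>f' - q\<close>, up to twice the linear
  term \<open>\<integral> (f - g) h + (f' - q) q\<close>, which vanishes by integration by parts for \<open>f\<close> and for \<open>g\<close>.\<close>

lemma
  assumes T: "T > 0" and b[measurable]: "b \<in> borel_measurable (Leb T)"
    and b2: "integrable (Leb T) (\<lambda>t. (b t)\<^sup>2)"
  shows energy_ge: "\<And>f. f \<in> W21 T \<Longrightarrow>
      (\<integral>t. (b t)\<^sup>2 \<partial>Leb T) - (\<integral>t. b t * green_op T b t \<partial>Leb T) \<le> energy T f b"
    and energy_green_op: "energy T (green_op T b) b =
      (\<integral>t. (b t)\<^sup>2 \<partial>Leb T) - (\<integral>t. b t * green_op T b t \<partial>Leb T)"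
proof -
  have b1: "integrable (Leb T) b"
    by (rule finite_measure.square_integrable_imp_integrable[OF finite_measure_Leb b b2])
  define g where "g = green_op T b"
  define q where "q = green_deriv_op T b"
  define h where "h t = g t - b t" for t
  have gW: "g \<in> W21 T" unfolding g_def by (rule green_op_W21[OF T b1])
  have gc: "continuous_on {0..T} g" by (rule W21_continuous[OF gW T])
  have qc: "continuous_on {0..T} q" unfolding q_def by (rule green_deriv_op_continuous[OF T b1])
  have [measurable]: "g \<in> borel_measurable (Leb T)" "q \<in> borel_measurable (Leb T)"
    using gc qc by (auto intro: continuous_on_Leb_measurable)
  have h2: "integrable (Leb T) (\<lambda>t. (h t)\<^sup>2)"
    unfolding h_def by (rule integrable_square_diff[OF _ _ continuous_square_integrable[OF gc] b2]) auto
  have hm [measurable]: "h \<in> borel_measurable (Leb T)" unfolding h_def by measurable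
  have h1: "integrable (Leb T) h"
    by (rule finite_measure.square_integrable_imp_integrable[OF finite_measure_Leb hm h2])
  have q2: "integrable (Leb T) (\<lambda>t. (q t)\<^sup>2)" by (rule continuous_square_integrable[OF qc])
  have h0: "(\<integral>t. h t \<partial>Leb T) = 0"
    unfolding h_def g_def by (rule green_op_residual_integral[OF T b1])
  have ibp: "(\<integral>t. q t * deriv f t \<partial>Leb T) = - (\<integral>t. f t * h t \<partial>Leb T)" if "f \<in> W21 T" for f
  proof -
    have "(\<integral>t. q t * deriv f t \<partial>Leb T) =
        (\<integral>t. deriv f t * (\<integral>s. (if s \<le> t then h s else 0) \<partial>Leb T) \<partial>Leb T)"
      unfolding h_def g_def q_def
      by (intro Bochner_Integration.integral_cong) (auto simp: green_op_integrals(2)[OF T b1])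
    also have "\<dots> = - (\<integral>t. f t * h t \<partial>Leb T)"
      by (rule W21_integration_by_parts[OF that T h1 h0])
    finally show ?thesis .
  qed
  have dg: "AE t in Leb T. deriv g t = q t"
    unfolding g_def q_def by (rule deriv_green_op_AE[OF T b1])
  have [measurable]: "deriv g \<in> borel_measurable (Leb T)" by (rule W21_measurable[OF gW T])
  have gh: "integrable (Leb T) (\<lambda>t. g t * h t)" by (rule continuous_mult_integrable[OF gc h1])
  have qq: "(\<integral>t. (q t)\<^sup>2 \<partial>Leb T) = - (\<integral>t. g t * h t \<partial>Leb T)"
  proof -
    have "(\<integral>t. (q t)\<^sup>2 \<partial>Leb T) = (\<integral>t. q t * deriv g t \<partial>Leb T)"
      by (rule integral_cong_AE) (use dg in \<open>auto simp: power2_eq_square\<close>)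
    then show ?thesis using ibp[OF gW] by simp
  qed
  have bh: "integrable (Leb T) (\<lambda>t. b t * g t)"
    using continuous_mult_integrable[OF gc b1] by (simp add: mult.commute)
  have val: "(\<integral>t. (h t)\<^sup>2 \<partial>Leb T) - (\<integral>t. g t * h t \<partial>Leb T)
      = (\<integral>t. (b t)\<^sup>2 \<partial>Leb T) - (\<integral>t. b t * green_op T b t \<partial>Leb T)"
  proof -
    have "(\<integral>t. (h t)\<^sup>2 \<partial>Leb T) - (\<integral>t. g t * h t \<partial>Leb T) = (\<integral>t. (h t)\<^sup>2 - g t * h t \<partial>Leb T)"
      using h2 gh by simp
    also have "\<dots> = (\<integral>t. (b t)\<^sup>2 - b t * g t \<partial>Leb T)"
      by (intro Bochner_Integration.integral_cong) (auto simp: h_def power2_eq_square algebra_simps)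
    also have "\<dots> = (\<integral>t. (b t)\<^sup>2 \<partial>Leb T) - (\<integral>t. b t * g t \<partial>Leb T)"
      using b2 bh by simp
    finally show ?thesis by (simp add: g_def)
  qed
  show "energy T (green_op T b) b = (\<integral>t. (b t)\<^sup>2 \<partial>Leb T) - (\<integral>t. b t * green_op T b t \<partial>Leb T)"
  proof -
    have "energy T g b = (\<integral>t. (h t)\<^sup>2 + (q t)\<^sup>2 \<partial>Leb T)"
      unfolding energy_eq_Leb h_def by (rule integral_cong_AE) (use dg in auto)
    also have "\<dots> = (\<integral>t. (h t)\<^sup>2 \<partial>Leb T) - (\<integral>t. g t * h t \<partial>Leb T)"
      using h2 q2 by (simp add: qq)
    finally show ?thesis using val by (simp add: g_def)
  qed
  fix f assume f: "f \<in> W21 T"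
  have fc: "continuous_on {0..T} f" by (rule W21_continuous[OF f T])
  have [measurable]: "f \<in> borel_measurable (Leb T)" by (rule continuous_on_Leb_measurable[OF fc])
  have f2: "integrable (Leb T) (\<lambda>t. (f t - b t)\<^sup>2)"
    by (rule integrable_square_diff[OF _ _ continuous_square_integrable[OF fc] b2]) auto
  have fh: "integrable (Leb T) (\<lambda>t. f t * h t)" by (rule continuous_mult_integrable[OF fc h1])
  have qf: "integrable (Leb T) (\<lambda>t. q t * deriv f t)"
    by (rule continuous_mult_integrable[OF qc W21_integrable[OF f T]])
  have "(\<integral>t. (h t)\<^sup>2 \<partial>Leb T) - (\<integral>t. g t * h t \<partial>Leb T)
      = (\<integral>t. (h t)\<^sup>2 + 2 * (f t * h t) - 2 * (g t * h t) + 2 * (q t * deriv f t) - (q t)\<^sup>2 \<partial>Leb T)"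
    using h2 fh gh qf q2 by (simp add: ibp[OF f] qq)
  also have "\<dots> \<le> (\<integral>t. (f t - b t)\<^sup>2 + (deriv f t)\<^sup>2 \<partial>Leb T)"
  proof (rule integral_mono)
    fix t
    have "(f t - b t)\<^sup>2 + (deriv f t)\<^sup>2 - ((h t)\<^sup>2 + 2 * (f t * h t) - 2 * (g t * h t) + 2 * (q t * deriv f t) - (q t)\<^sup>2)
       = (f t - g t)\<^sup>2 + (deriv f t - q t)\<^sup>2"
      by (simp add: h_def power2_eq_square algebra_simps)
    then show "(h t)\<^sup>2 + 2 * (f t * h t) - 2 * (g t * h t) + 2 * (q t * deriv f t) - (q t)\<^sup>2
        \<le> (f t - b t)\<^sup>2 + (deriv f t)\<^sup>2"
      by (smt (verit) zero_le_power2)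
  qed (use h2 fh gh qf q2 f2 W21_square_integrable[OF f T] in simp_all)
  finally show "(\<integral>t. (b t)\<^sup>2 \<partial>Leb T) - (\<integral>t. b t * green_op T b t \<partial>Leb T) \<le> energy T f b"
    unfolding energy_eq_Leb val .
qed

text \<open>All minimizers have the same energy, so one explicit minimizer determines the energy of the one
  chosen by \<open>arg_min\<close>.\<close>

lemma energy_minimizer_eq:
  assumes "g \<in> W21 T" "\<And>f. f \<in> W21 T \<Longrightarrow> energy T g b \<le> energy T f b"
  shows "energy T (energy_minimizer T b) b = energy T g b"
proof -
  have "is_arg_min (\<lambda>f. energy T f b) (\<lambda>f. f \<in> W21 T) (energy_minimizer T b)"
    unfolding energy_minimizer_def arg_min_def
    by (rule someI[of _ g]) (use assms in \<open>auto simp: is_arg_min_linorder\<close>)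
  then have "energy_minimizer T b \<in> W21 T" "energy T (energy_minimizer T b) b \<le> energy T g b"
    using assms(1) by (auto simp: is_arg_min_linorder)
  then show ?thesis using assms(2) by (intro antisym)
qed

lemma green_section_measurable [measurable]: "green T t \<in> borel_measurable (Leb T')"
  unfolding green_def[abs_def] by (intro borel_measurable_Leb) measurable

lemma green_pair_Leb [measurable]: "(\<lambda>(t, s). green T t s) \<in> borel_measurable (Leb T \<Otimes>\<^sub>M Leb T)"
  by (rule borel_measurable_Leb_pair) (rule green_measurable)

text \<open>Expanding the square, the two diagonal terms each give \<open>\<integral> b\<^sup>2\<close> because the rows and the columns
  of the symmetric kernel integrate to one; the mixed term is \<open>- 2 \<integral> b (green_op T b)\<close>.\<close>

lemma green_dirichlet_form:
  assumes T: "T > 0" and b[measurable]: "b \<in> borel_measurable (Leb T)"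
    and b2: "integrable (Leb T) (\<lambda>t. (b t)\<^sup>2)"
  shows "(\<integral>\<^sup>+t. \<integral>\<^sup>+s. ennreal (green T t s * (b t - b s)\<^sup>2) \<partial>Leb T \<partial>Leb T) =
    ennreal (2 * ((\<integral>t. (b t)\<^sup>2 \<partial>Leb T) - (\<integral>t. b t * green_op T b t \<partial>Leb T)))"
proof -
  have b1: "integrable (Leb T) b"
    by (rule finite_measure.square_integrable_imp_integrable[OF finite_measure_Leb b b2])
  have one: "integrable (Leb T) (\<lambda>_. 1 :: real)"
    by (rule integrable_Leb_bounded[where C = 1]) auto
  let ?b2 = "\<lambda>t. (b t)\<^sup>2"
  have G: "integrable (Leb T) (\<lambda>s. green T t s * u s)" if "t \<in> {0..T}" "integrable (Leb T) u" for t u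
    by (rule integrable_bounded_mult[where C = "cosh T * cosh T / sinh T + cosh T"])
       (use that green_bound[OF T] in auto)
  have inner: "integrable (Leb T) (\<lambda>s. green T t s * (b t - b s)\<^sup>2)"
      "(\<integral>s. green T t s * (b t - b s)\<^sup>2 \<partial>Leb T) = (b t)\<^sup>2 - 2 * (b t * green_op T b t) + green_op T ?b2 t"
    if t: "t \<in> {0..T}" for t
  proof -
    have eq: "green T t s * (b t - b s)\<^sup>2 = (b t)\<^sup>2 * (green T t s * 1) - 2 * b t * (green T t s * b s) + green T t s * (b s)\<^sup>2" for s
      by (simp add: power2_eq_square algebra_simps)
    show "integrable (Leb T) (\<lambda>s. green T t s * (b t - b s)\<^sup>2)"
      unfolding eq using G[OF t one] G[OF t b1] G[OF t b2] by (intro Bochner_Integration.integrable_add Bochner_Integration.integrable_diff integrable_mult_right) auto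
    have "(\<integral>s. green T t s \<partial>Leb T) = 1" using t T by (intro integral_green_1) auto
    then show "(\<integral>s. green T t s * (b t - b s)\<^sup>2 \<partial>Leb T) = (b t)\<^sup>2 - 2 * (b t * green_op T b t) + green_op T ?b2 t"
      unfolding eq using G[OF t one] G[OF t b1] G[OF t b2] by (simp add: green_op_def)
  qed
  have ib: "integrable (Leb T) (\<lambda>t. b t * green_op T b t)" by (rule green_swap(1)[OF T b1 b1])
  have ib2: "integrable (Leb T) (green_op T ?b2)" by (rule green_op_integrable(1)[OF T b2])
  have "(\<integral>t. green_op T ?b2 t \<partial>Leb T) = (\<integral>s. (b s)\<^sup>2 * (\<integral>t. green T t s \<partial>Leb T) \<partial>Leb T)"
    using green_swap(3)[OF T one b2] by simp
  also have "\<dots> = (\<integral>s. (b s)\<^sup>2 \<partial>Leb T)"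
    using T by (intro Bochner_Integration.integral_cong) (auto simp: integral_green_1)
  finally have e2: "(\<integral>t. green_op T ?b2 t \<partial>Leb T) = (\<integral>s. (b s)\<^sup>2 \<partial>Leb T)" .
  have "(\<integral>\<^sup>+t. \<integral>\<^sup>+s. ennreal (green T t s * (b t - b s)\<^sup>2) \<partial>Leb T \<partial>Leb T)
     = (\<integral>\<^sup>+t. ennreal ((b t)\<^sup>2 - 2 * (b t * green_op T b t) + green_op T ?b2 t) \<partial>Leb T)"
  proof (rule nn_integral_cong)
    fix t assume "t \<in> space (Leb T)"
    then have t: "t \<in> {0..T}" by simp
    show "(\<integral>\<^sup>+s. ennreal (green T t s * (b t - b s)\<^sup>2) \<partial>Leb T) = ennreal ((b t)\<^sup>2 - 2 * (b t * green_op T b t) + green_op T ?b2 t)"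
      using inner[OF t] green_nonneg[OF T] by (subst nn_integral_eq_integral) auto
  qed
  also have "\<dots> = ennreal (\<integral>t. (b t)\<^sup>2 - 2 * (b t * green_op T b t) + green_op T ?b2 t \<partial>Leb T)"
  proof (rule nn_integral_eq_integral)
    show "AE t in Leb T. 0 \<le> (b t)\<^sup>2 - 2 * (b t * green_op T b t) + green_op T ?b2 t"
    proof (rule AE_I2)
      fix t assume "t \<in> space (Leb T)"
      then have t: "t \<in> {0..T}" by simp
      show "0 \<le> (b t)\<^sup>2 - 2 * (b t * green_op T b t) + green_op T ?b2 t"
        unfolding inner(2)[OF t, symmetric] by (intro integral_nonneg_AE AE_I2) (simp add: green_nonneg[OF T])
    qed
  qed (use b2 ib ib2 in auto)
  also have "(\<integral>t. (b t)\<^sup>2 - 2 * (b t * green_op T b t) + green_op T ?b2 t \<partial>Leb T)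
     = 2 * ((\<integral>t. (b t)\<^sup>2 \<partial>Leb T) - (\<integral>t. b t * green_op T b t \<partial>Leb T))"
    using b2 ib ib2 by (simp add: e2)
  finally show ?thesis .
qed

text \<open>The kernel is bounded below by a positive constant, so if the form is finite, then
  \<open>b t - b\<close> is square integrable for some fixed \<open>t\<close>.\<close>

lemma green_dirichlet_form_infinite:
  assumes T: "T > 0" and b[measurable]: "b \<in> borel_measurable (Leb T)"
    and fin: "(\<integral>\<^sup>+t. \<integral>\<^sup>+s. ennreal (green T t s * (b t - b s)\<^sup>2) \<partial>Leb T \<partial>Leb T) \<noteq> \<infinity>"
  shows "integrable (Leb T) (\<lambda>t. (b t)\<^sup>2)"
proof -
  interpret finite_measure "Leb T" by (rule finite_measure_Leb)
  interpret sigma_finite_measure "Leb T" by (rule sigma_finite_Leb)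
  have m: "(\<lambda>(t, s). ennreal (green T t s * (b t - b s)\<^sup>2)) \<in> borel_measurable (Leb T \<Otimes>\<^sub>M Leb T)"
    by measurable
  have "(\<lambda>t. \<integral>\<^sup>+s. ennreal (green T t s * (b t - b s)\<^sup>2) \<partial>Leb T) \<in> borel_measurable (Leb T)"
    using borel_measurable_nn_integral[OF m] by simp
  then have "AE t in Leb T. (\<integral>\<^sup>+s. ennreal (green T t s * (b t - b s)\<^sup>2) \<partial>Leb T) \<noteq> \<infinity>"
    using fin by (rule nn_integral_PInf_AE)
  moreover have "\<not> (AE t in Leb T. False)"
  proof -
    have "emeasure (Leb T) {0..T} = ennreal T"
      using T by (subst emeasure_restrict_space) auto
    then have pos: "emeasure (Leb T) {0..T} > 0" using T by simp
    show ?thesis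
    proof
      assume "AE t in Leb T. False"
      from AE_E3[OF this] obtain N where N: "\<And>t. t \<in> space (Leb T) - N \<Longrightarrow> False" "N \<in> null_sets (Leb T)"
        by blast
      have "emeasure (Leb T) {0..T} \<le> emeasure (Leb T) N"
      proof (rule emeasure_mono)
        show "{0..T} \<subseteq> N"
        proof
          fix t assume "t \<in> {0..T}"
          then show "t \<in> N" using N(1)[of t] by auto
        qed
      qed (use N(2) in auto)
      also have "\<dots> = 0" using N(2) by (rule null_setsD1)
      finally show False using pos leD by blast
    qed
  qed
  ultimately obtain t where t: "(\<integral>\<^sup>+s. ennreal (green T t s * (b t - b s)\<^sup>2) \<partial>Leb T) \<noteq> \<infinity>"
    by (metis (mono_tags, lifting) eventually_mono)
  have s: "sinh T > 0" using T by simp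
  have "(\<integral>\<^sup>+s. ennreal ((b t - b s)\<^sup>2) \<partial>Leb T) \<le> (\<integral>\<^sup>+s. ennreal (sinh T) * ennreal (green T t s * (b t - b s)\<^sup>2) \<partial>Leb T)"
  proof (rule nn_integral_mono)
    fix s
    have "1 \<le> sinh T * green T t s"
      using green_ge[OF T, of t s] \<open>sinh T > 0\<close> by (simp add: field_simps)
    then have "1 * (b t - b s)\<^sup>2 \<le> sinh T * green T t s * (b t - b s)\<^sup>2"
      by (rule mult_right_mono) simp
    then show "ennreal ((b t - b s)\<^sup>2) \<le> ennreal (sinh T) * ennreal (green T t s * (b t - b s)\<^sup>2)"
      using \<open>sinh T > 0\<close> green_nonneg[OF T] by (simp flip: ennreal_mult add: mult.assoc)
  qed
  also have "\<dots> = ennreal (sinh T) * (\<integral>\<^sup>+s. ennreal (green T t s * (b t - b s)\<^sup>2) \<partial>Leb T)"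
    by (rule nn_integral_cmult) measurable
  also have "\<dots> < \<infinity>" using t by (simp add: ennreal_mult_less_top less_top)
  finally have "integrable (Leb T) (\<lambda>s. (b t - b s)\<^sup>2)"
    by (intro integrableI_bounded) auto
  then have "integrable (Leb T) (\<lambda>s. (b t - (b t - b s))\<^sup>2)"
    by (intro integrable_square_diff[of "\<lambda>_. b t" "Leb T" "\<lambda>s. b t - b s"]) auto
  then show ?thesis by simp
qed

text \<open>The integral of a function that is not integrable is zero by convention, and a function in \<open>W21\<close>
  is bounded, so it cannot compensate for \<open>b\<close>.\<close>

lemma energy_not_square_integrable:
  assumes T: "T > 0" and b[measurable]: "b \<in> borel_measurable (Leb T)"
    and b2: "\<not> integrable (Leb T) (\<lambda>t. (b t)\<^sup>2)" and f: "f \<in> W21 T"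
  shows "energy T f b = 0"
proof -
  have fc: "continuous_on {0..T} f" by (rule W21_continuous[OF f T])
  have [measurable]: "f \<in> borel_measurable (Leb T)" by (rule continuous_on_Leb_measurable[OF fc])
  have "\<not> integrable (Leb T) (\<lambda>s. (f s - b s)\<^sup>2 + (deriv f s)\<^sup>2)"
  proof
    assume "integrable (Leb T) (\<lambda>s. (f s - b s)\<^sup>2 + (deriv f s)\<^sup>2)"
    from Bochner_Integration.integrable_diff[OF this W21_square_integrable[OF f T]]
    have "integrable (Leb T) (\<lambda>s. (f s - b s)\<^sup>2)" by simp
    then have "integrable (Leb T) (\<lambda>s. (f s - (f s - b s))\<^sup>2)"
      by (rule integrable_square_diff[OF _ _ continuous_square_integrable[OF fc], rotated 2]) measurable
    then show False using b2 by simp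
  qed
  then show ?thesis unfolding energy_eq_Leb by (rule not_integrable_integral_eq)
qed

text \<open>The formula holds for every measurable path: when \<open>b\<close> is not square integrable, the form is
  infinite, \<open>enn2real\<close> maps it to zero, and all energies are zero as well.  This makes the minimal
  energy of a random path a measurable function of the outcome, exceptional paths included.\<close>

lemma min_energy_eq:
  assumes T: "T > 0" and b: "b \<in> borel_measurable (Leb T)"
  shows "energy T (energy_minimizer T b) b =
    enn2real ((\<integral>\<^sup>+t. \<integral>\<^sup>+s. ennreal (green T t s * (b t - b s)\<^sup>2) \<partial>Leb T \<partial>Leb T)) / 2"
proof (cases "integrable (Leb T) (\<lambda>t. (b t)\<^sup>2)")
  case True
  have W: "green_op T b \<in> W21 T"
    by (intro green_op_W21 T finite_measure.square_integrable_imp_integrable[OF finite_measure_Leb b True])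
  have "energy T (energy_minimizer T b) b = energy T (green_op T b) b"
    by (rule energy_minimizer_eq[OF W]) (simp add: energy_ge[OF T b True] energy_green_op[OF T b True])
  moreover have "0 \<le> energy T (green_op T b) b"
    unfolding energy_eq_Leb by (intro integral_nonneg_AE AE_I2) simp
  ultimately show ?thesis
    by (simp add: green_dirichlet_form[OF T b True] energy_green_op[OF T b True])
next
  case False
  have z: "energy T f b = 0" if "f \<in> W21 T" for f
    by (rule energy_not_square_integrable[OF T b False that])
  have W: "(\<lambda>_. 0) \<in> W21 T"
    using green_op_W21[OF T, of "\<lambda>_. 0"] by (simp add: green_op_def[abs_def])
  have "energy T (energy_minimizer T b) b = energy T (\<lambda>_. 0) b"
    by (rule energy_minimizer_eq[OF W]) (simp add: z W)
  also have "\<dots> = 0" by (rule z[OF W])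
  finally have "energy T (energy_minimizer T b) b = 0" .
  moreover have "(\<integral>\<^sup>+t. \<integral>\<^sup>+s. ennreal (green T t s * (b t - b s)\<^sup>2) \<partial>Leb T \<partial>Leb T) = \<infinity>"
    using green_dirichlet_form_infinite[OF T b] False by blast
  ultimately show ?thesis by (simp only:) simp
qed

section \<open>Second moments of the process\<close>

lemma norm_square_add_le:
  fixes a b :: "'b::real_normed_vector"
  shows "(norm (a + b))\<^sup>2 \<le> 2 * (norm a)\<^sup>2 + 2 * (norm b)\<^sup>2"
proof -
  have "(norm (a + b))\<^sup>2 \<le> (norm a + norm b)\<^sup>2" by (intro power_mono norm_triangle_ineq) auto
  also have "\<dots> \<le> 2 * (norm a)\<^sup>2 + 2 * (norm b)\<^sup>2"
    using zero_le_power2[of "norm a - norm b"] by (simp add: power2_eq_square algebra_simps)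
  finally show ?thesis .
qed

text \<open>Young's inequality with a free parameter: it bounds the difference of two squared norms by a
  small multiple of one of them plus a multiple of the squared distance.\<close>

lemma norm_square_diff_le:
  fixes a b :: "'b::real_normed_vector"
  assumes "\<epsilon> > 0"
  shows "\<bar>(norm b)\<^sup>2 - (norm a)\<^sup>2\<bar> \<le> (1 + 1 / \<epsilon>) * (norm (a - b))\<^sup>2 + \<epsilon> * (norm a)\<^sup>2"
proof -
  define x y z where "x = norm a" "y = norm b" "z = norm (a - b)"
  have tri: "\<bar>y - x\<bar> \<le> z" "0 \<le> x" "0 \<le> y"
    by (auto simp: x_y_z_def norm_triangle_ineq3 norm_minus_commute abs_minus_commute)
  have "\<bar>y\<^sup>2 - x\<^sup>2\<bar> = \<bar>y - x\<bar> * (y + x)"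
    using tri by (simp add: power2_eq_square square_diff_square_factored abs_mult mult.commute)
  also have "\<dots> \<le> z * (z + 2 * x)" using tri by (intro mult_mono) auto
  also have "\<dots> \<le> (1 + 1 / \<epsilon>) * z\<^sup>2 + \<epsilon> * x\<^sup>2"
  proof -
    have "0 \<le> (z / sqrt \<epsilon> - sqrt \<epsilon> * x)\<^sup>2" by simp
    also have "\<dots> = z\<^sup>2 / \<epsilon> - 2 * z * x + \<epsilon> * x\<^sup>2"
      using assms by (simp add: power2_diff power_divide power_mult_distrib)
    finally show ?thesis by (simp add: algebra_simps power2_eq_square)
  qed
  finally show ?thesis by (simp add: x_y_z_def)
qed

text \<open>Second moments are continuous under mean-square convergence.  The lemma is used on both sides of
  the isometry, on the probability space and on the spectral side.\<close>

lemma mean_square_limit: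
  fixes f :: "'a \<Rightarrow> 'b::{real_normed_vector, second_countable_topology}" and F :: "nat \<Rightarrow> 'a \<Rightarrow> 'b"
  assumes f[measurable]: "f \<in> borel_measurable M" and F[measurable]: "\<And>n. F n \<in> borel_measurable M"
    and F2: "\<And>n. integrable M (\<lambda>x. (norm (F n x))\<^sup>2)"
    and lim: "(\<lambda>n. \<integral>\<^sup>+x. ennreal ((norm (f x - F n x))\<^sup>2) \<partial>M) \<longlonglongrightarrow> 0"
  shows "integrable M (\<lambda>x. (norm (f x))\<^sup>2)"
    and "(\<lambda>n. \<integral>x. (norm (F n x))\<^sup>2 \<partial>M) \<longlonglongrightarrow> (\<integral>x. (norm (f x))\<^sup>2 \<partial>M)"
proof -
  define d where "d n = (\<integral>\<^sup>+x. ennreal ((norm (f x - F n x))\<^sup>2) \<partial>M)" for n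
  have dlim: "d \<longlonglongrightarrow> 0" using lim by (simp add: d_def[abs_def])
  then have fin: "eventually (\<lambda>n. d n < \<infinity>) sequentially"
    by (rule order_tendstoD) simp
  have int: "integrable M (\<lambda>x. (norm (f x - F n x))\<^sup>2)" "(\<integral>x. (norm (f x - F n x))\<^sup>2 \<partial>M) = enn2real (d n)"
    if "d n < \<infinity>" for n
  proof -
    show i: "integrable M (\<lambda>x. (norm (f x - F n x))\<^sup>2)"
      using that by (intro integrableI_bounded) (auto simp: d_def)
    show "(\<integral>x. (norm (f x - F n x))\<^sup>2 \<partial>M) = enn2real (d n)"
      unfolding d_def by (rule integral_eq_nn_integral) auto
  qed
  obtain n0 where n0: "d n0 < \<infinity>" using fin by (auto simp: eventually_sequentially)
  show f2: "integrable M (\<lambda>x. (norm (f x))\<^sup>2)"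
  proof (rule Bochner_Integration.integrable_bound)
    show "integrable M (\<lambda>x. 2 * (norm (f x - F n0 x))\<^sup>2 + 2 * (norm (F n0 x))\<^sup>2)"
      using int(1)[OF n0] F2 by auto
    show "AE x in M. norm ((norm (f x))\<^sup>2) \<le> norm (2 * (norm (f x - F n0 x))\<^sup>2 + 2 * (norm (F n0 x))\<^sup>2)"
      by (rule AE_I2) (use norm_square_add_le[of "f x - F n0 x" "F n0 x" for x] in simp)
  qed simp
  define a where "a = (\<integral>x. (norm (f x))\<^sup>2 \<partial>M)"
  have a: "a \<ge> 0" by (simp add: a_def)
  show "(\<lambda>n. \<integral>x. (norm (F n x))\<^sup>2 \<partial>M) \<longlonglongrightarrow> (\<integral>x. (norm (f x))\<^sup>2 \<partial>M)"
    unfolding tendsto_iff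
  proof (intro allI impI)
    fix e :: real assume e: "e > 0"
    define \<epsilon> where "\<epsilon> = e / (2 * (a + 1))"
    have \<epsilon>: "\<epsilon> > 0" using a e by (simp add: \<epsilon>_def)
    have "\<epsilon> * a < \<epsilon> * (a + 1)" using \<epsilon> by simp
    also have "\<dots> = e / 2"
    proof -
      have "e / (2 * c) * c = e / 2" if "c > 0" for c using that by simp
      from this[of "a + 1"] show ?thesis using a by (simp only: \<epsilon>_def)
    qed
    finally have \<epsilon>a: "\<epsilon> * a < e / 2" .
    define \<eta> where "\<eta> = e / 2 / (1 + 1 / \<epsilon>)"
    have p: "1 + 1 / \<epsilon> > 0" using \<epsilon> by (simp add: add_pos_pos)
    have \<eta>: "\<eta> > 0" using e p by (simp add: \<eta>_def)
    have "eventually (\<lambda>n. d n < ennreal \<eta>) sequentially"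
      using dlim by (rule order_tendstoD) (use \<eta> in simp)
    then show "eventually (\<lambda>n. dist (\<integral>x. (norm (F n x))\<^sup>2 \<partial>M) (\<integral>x. (norm (f x))\<^sup>2 \<partial>M) < e) sequentially"
      using fin
    proof eventually_elim
      case (elim n)
      have "\<bar>(\<integral>x. (norm (F n x))\<^sup>2 \<partial>M) - (\<integral>x. (norm (f x))\<^sup>2 \<partial>M)\<bar> = \<bar>\<integral>x. (norm (F n x))\<^sup>2 - (norm (f x))\<^sup>2 \<partial>M\<bar>"
        using F2 f2 by simp
      also have "\<dots> \<le> (\<integral>x. \<bar>(norm (F n x))\<^sup>2 - (norm (f x))\<^sup>2\<bar> \<partial>M)" by (rule integral_abs_bound)
      also have "\<dots> \<le> (\<integral>x. (1 + 1 / \<epsilon>) * (norm (f x - F n x))\<^sup>2 + \<epsilon> * (norm (f x))\<^sup>2 \<partial>M)"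
        using F2 f2 int(1)[OF elim(2)] by (intro integral_mono norm_square_diff_le[OF \<epsilon>]) auto
      also have "\<dots> = (1 + 1 / \<epsilon>) * enn2real (d n) + \<epsilon> * a"
        using f2 int[OF elim(2)] by (simp add: a_def)
      also have "enn2real (d n) < \<eta>"
        using elim(1) \<eta> by (metis enn2real_ennreal enn2real_less_iff ennreal_less_iff elim(2) infinity_ennreal_def less_imp_le ennreal_enn2real enn2real_nonneg)
      then have "(1 + 1 / \<epsilon>) * enn2real (d n) + \<epsilon> * a < (1 + 1 / \<epsilon>) * \<eta> + e / 2"
        using p \<epsilon>a by (intro add_strict_mono mult_strict_left_mono) auto
      also have "\<dots> = e"
      proof -
        have "c * (e / 2 / c) + e / 2 = e" if "c > 0" for c using that by simp
        from this[OF p] show ?thesis by (simp only: \<eta>_def)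
      qed
      finally show ?case by (simp add: dist_real_def)
    qed
  qed
qed

lemma cnj_measurable [measurable]: "cnj \<in> borel_measurable borel"
  by (intro borel_measurable_continuous_onI continuous_intros)

lemma mean_square_product_integrable:
  fixes f g :: "'a \<Rightarrow> complex"
  assumes [measurable]: "f \<in> borel_measurable M" "g \<in> borel_measurable M"
    and "integrable M (\<lambda>x. (norm (f x))\<^sup>2)" "integrable M (\<lambda>x. (norm (g x))\<^sup>2)"
  shows "integrable M (\<lambda>x. f x * cnj (g x))"
proof (rule Bochner_Integration.integrable_bound)
  show "integrable M (\<lambda>x. (norm (f x))\<^sup>2 + (norm (g x))\<^sup>2)" using assms(3,4) by simp
  have "x * y \<le> x\<^sup>2 + y\<^sup>2" for x y :: real
  proof -
    have "0 \<le> (x - y)\<^sup>2 + x\<^sup>2 + y\<^sup>2" by simp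
    also have "\<dots> = 2 * (x\<^sup>2 + y\<^sup>2 - x * y)" by (simp add: power2_eq_square algebra_simps)
    finally show ?thesis by simp
  qed
  then show "AE x in M. norm (f x * cnj (g x)) \<le> norm ((norm (f x))\<^sup>2 + (norm (g x))\<^sup>2)"
    by (intro AE_I2) (simp add: norm_mult)
qed measurable

lemma orthogonal_sum:
  fixes W :: "'i \<Rightarrow> 'a \<Rightarrow> complex"
  assumes I: "finite I" and m[measurable]: "\<And>i. i \<in> I \<Longrightarrow> W i \<in> borel_measurable M"
    and W2: "\<And>i. i \<in> I \<Longrightarrow> integrable M (\<lambda>x. (cmod (W i x))\<^sup>2)"
    and orth: "\<And>i j. i \<in> I \<Longrightarrow> j \<in> I \<Longrightarrow> i \<noteq> j \<Longrightarrow> (\<integral>x. W i x * cnj (W j x) \<partial>M) = 0"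
  shows "integrable M (\<lambda>x. (cmod (\<Sum>i\<in>I. W i x))\<^sup>2)"
    and "(\<integral>x. (cmod (\<Sum>i\<in>I. W i x))\<^sup>2 \<partial>M) = (\<Sum>i\<in>I. \<integral>x. (cmod (W i x))\<^sup>2 \<partial>M)"
proof -
  have ij: "integrable M (\<lambda>x. W i x * cnj (W j x))" if "i \<in> I" "j \<in> I" for i j
    by (intro mean_square_product_integrable m W2 that)
  have eq: "complex_of_real ((cmod (\<Sum>i\<in>I. W i x))\<^sup>2) = (\<Sum>i\<in>I. \<Sum>j\<in>I. W i x * cnj (W j x))" for x
    by (simp only: complex_norm_square cnj_sum sum_product)
  have int: "integrable M (\<lambda>x. complex_of_real ((cmod (\<Sum>i\<in>I. W i x))\<^sup>2))"
    unfolding eq by (intro Bochner_Integration.integrable_sum ij)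
  then show "integrable M (\<lambda>x. (cmod (\<Sum>i\<in>I. W i x))\<^sup>2)"
    using complex_of_real_integrable_eq by blast
  have "complex_of_real (\<integral>x. (cmod (\<Sum>i\<in>I. W i x))\<^sup>2 \<partial>M) = (\<integral>x. (\<Sum>i\<in>I. \<Sum>j\<in>I. W i x * cnj (W j x)) \<partial>M)"
    by (simp only: integral_complex_of_real[symmetric] eq)
  also have "\<dots> = (\<Sum>i\<in>I. \<Sum>j\<in>I. \<integral>x. W i x * cnj (W j x) \<partial>M)"
    by (simp add: Bochner_Integration.integral_sum Bochner_Integration.integrable_sum ij)
  also have "\<dots> = (\<Sum>i\<in>I. \<integral>x. W i x * cnj (W i x) \<partial>M)"
  proof (rule sum.cong[OF refl])
    fix i assume i: "i \<in> I"
    have "(\<Sum>j\<in>I. \<integral>x. W i x * cnj (W j x) \<partial>M) = (\<Sum>j\<in>I. if j = i then \<integral>x. W i x * cnj (W i x) \<partial>M else 0)"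
      using orth i by (intro sum.cong) auto
    then show "(\<Sum>j\<in>I. \<integral>x. W i x * cnj (W j x) \<partial>M) = (\<integral>x. W i x * cnj (W i x) \<partial>M)"
      using I i by simp
  qed
  also have "\<dots> = complex_of_real (\<Sum>i\<in>I. \<integral>x. (cmod (W i x))\<^sup>2 \<partial>M)"
    by (simp only: of_real_sum integral_complex_of_real[symmetric] complex_norm_square)
  finally show "(\<integral>x. (cmod (\<Sum>i\<in>I. W i x))\<^sup>2 \<partial>M) = (\<Sum>i\<in>I. \<integral>x. (cmod (W i x))\<^sup>2 \<partial>M)"
    by (simp only: of_real_eq_iff)
qed

text \<open>The value \<open>0\<close> is removed because its level set may have infinite measure.\<close>

lemma integral_simple_norm_square:
  fixes s :: "'a \<Rightarrow> complex"
  assumes s: "simple_function \<mu> s" and fin: "emeasure \<mu> {u \<in> space \<mu>. s u \<noteq> 0} < \<infinity>"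
  shows "integrable \<mu> (\<lambda>u. (cmod (s u))\<^sup>2)"
    and "(\<integral>u. (cmod (s u))\<^sup>2 \<partial>\<mu>) = (\<Sum>z\<in>s ` space \<mu> - {0}. (cmod z)\<^sup>2 * measure \<mu> (s -` {z} \<inter> space \<mu>))"
    and "\<And>z. z \<noteq> 0 \<Longrightarrow> s -` {z} \<inter> space \<mu> \<in> sets \<mu> \<and> emeasure \<mu> (s -` {z} \<inter> space \<mu>) < \<infinity>"
proof -
  have fI: "finite (s ` space \<mu>)" and sets: "s -` {z} \<inter> space \<mu> \<in> sets \<mu>" for z
    using s simple_functionD[OF s] by auto
  have ne: "{u \<in> space \<mu>. s u \<noteq> 0} \<in> sets \<mu>"
  proof -
    have "{u \<in> space \<mu>. s u \<noteq> 0} = space \<mu> - (s -` {0} \<inter> space \<mu>)" by auto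
    then show ?thesis using sets by auto
  qed
  show A: "s -` {z} \<inter> space \<mu> \<in> sets \<mu> \<and> emeasure \<mu> (s -` {z} \<inter> space \<mu>) < \<infinity>" if "z \<noteq> 0" for z
  proof
    have "emeasure \<mu> (s -` {z} \<inter> space \<mu>) \<le> emeasure \<mu> {u \<in> space \<mu>. s u \<noteq> 0}"
      using that by (intro emeasure_mono ne) auto
    then show "emeasure \<mu> (s -` {z} \<inter> space \<mu>) < \<infinity>" using fin by (rule le_less_trans)
  qed (rule sets)
  define I where "I = s ` space \<mu> - {0}"
  have I: "finite I" using fI by (simp add: I_def)
  have eq: "(cmod (s u))\<^sup>2 = (\<Sum>z\<in>I. (cmod z)\<^sup>2 * indicator (s -` {z} \<inter> space \<mu>) u)" if "u \<in> space \<mu>" for u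
  proof -
    have "(\<Sum>z\<in>I. (cmod z)\<^sup>2 * indicator (s -` {z} \<inter> space \<mu>) u) = (\<Sum>z\<in>I. if z = s u then (cmod (s u))\<^sup>2 else 0)"
      using that by (intro sum.cong) (auto simp: indicator_def)
    also have "\<dots> = (cmod (s u))\<^sup>2" using I that by (auto simp: I_def)
    finally show ?thesis by simp
  qed
  have int: "integrable \<mu> (\<lambda>u. (cmod z)\<^sup>2 * indicator (s -` {z} \<inter> space \<mu>) u)" if "z \<in> I" for z
    using A[of z] that by (intro integrable_mult_right integrable_real_indicator) (auto simp: I_def)
  then have "integrable \<mu> (\<lambda>u. \<Sum>z\<in>I. (cmod z)\<^sup>2 * indicator (s -` {z} \<inter> space \<mu>) u)"
    by (rule Bochner_Integration.integrable_sum)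
  then show "integrable \<mu> (\<lambda>u. (cmod (s u))\<^sup>2)"
    by (subst Bochner_Integration.integrable_cong[OF refl eq])
  have "(\<integral>u. (cmod (s u))\<^sup>2 \<partial>\<mu>) = (\<integral>u. (\<Sum>z\<in>I. (cmod z)\<^sup>2 * indicator (s -` {z} \<inter> space \<mu>) u) \<partial>\<mu>)"
    by (intro Bochner_Integration.integral_cong refl eq)
  also have "\<dots> = (\<Sum>z\<in>I. \<integral>u. (cmod z)\<^sup>2 * indicator (s -` {z} \<inter> space \<mu>) u \<partial>\<mu>)"
    by (rule Bochner_Integration.integral_sum) (rule int)
  also have "\<dots> = (\<Sum>z\<in>I. (cmod z)\<^sup>2 * measure \<mu> (s -` {z} \<inter> space \<mu>))"
    by (intro sum.cong) auto
  finally show "(\<integral>u. (cmod (s u))\<^sup>2 \<partial>\<mu>) = (\<Sum>z\<in>s ` space \<mu> - {0}. (cmod z)\<^sup>2 * measure \<mu> (s -` {z} \<inter> space \<mu>))"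
    by (simp add: I_def)
qed

text \<open>The variables \<open>D c\<close> and \<open>z X(s = z)\<close>, for the finitely many nonzero values \<open>z\<close> of \<open>s\<close>, are pairwise
  orthogonal, so their second moments add up.  The drift term belongs to the family because the
  approximations of \<open>B t\<close> consist of the drift plus a simple integral.\<close>

lemma
  assumes M: "prob_space M" and X: "uncorrelated_random_measure M \<mu> X"
    and D: "finite_second_moment M D"
    and DX: "\<forall>A\<in>sets \<mu>. emeasure \<mu> A < \<infinity> \<longrightarrow> complex_covariance M (\<lambda>\<omega>. complex_of_real (D \<omega>)) (X A) = 0"
    and s: "simple_function \<mu> s" and fin: "emeasure \<mu> {u \<in> space \<mu>. s u \<noteq> 0} < \<infinity>"
  shows simple_stochastic_integral_measurable: "simple_stochastic_integral \<mu> X s \<in> borel_measurable M"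
    and simple_stochastic_integral_square_integrable:
      "integrable M (\<lambda>\<omega>. (cmod (of_real (D \<omega> * c) + simple_stochastic_integral \<mu> X s \<omega>))\<^sup>2)"
    and simple_stochastic_integral_isometry:
      "(\<integral>\<omega>. (cmod (of_real (D \<omega> * c) + simple_stochastic_integral \<mu> X s \<omega>))\<^sup>2 \<partial>M) =
        c\<^sup>2 * (\<integral>\<omega>. (D \<omega>)\<^sup>2 \<partial>M) + (\<integral>u. (cmod (s u))\<^sup>2 \<partial>\<mu>)"
proof -
  interpret prob_space M by fact
  define A where "A z = s -` {z} \<inter> space \<mu>" for z
  define I where "I = s ` space \<mu> - {0}"
  have I: "finite I" using simple_functionD(1)[OF s] by (simp add: I_def)
  have A: "A z \<in> sets \<mu>" "emeasure \<mu> (A z) < \<infinity>" if "z \<in> I" for z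
    using integral_simple_norm_square(3)[OF s fin, of z] that by (auto simp: A_def I_def)
  have S: "simple_stochastic_integral \<mu> X s \<omega> = (\<Sum>z\<in>I. z * X (A z) \<omega>)" for \<omega>
    unfolding simple_stochastic_integral_def A_def I_def
    using simple_functionD(1)[OF s] by (intro sum.mono_neutral_right) auto
  have Xm [measurable]: "X (A z) \<in> borel_measurable M"
    and X2: "integrable M (\<lambda>\<omega>. (cmod (X (A z) \<omega>))\<^sup>2)"
    and X0: "(\<integral>\<omega>. X (A z) \<omega> \<partial>M) = 0"
    and X\<mu>: "(\<integral>\<omega>. (cmod (X (A z) \<omega>))\<^sup>2 \<partial>M) = measure \<mu> (A z)" if "z \<in> I" for z
    using X A[OF that] by (auto simp: uncorrelated_random_measure_def finite_second_moment_def measure_def)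
  have uncorr: "complex_covariance M (X E) (X E') = 0"
    if "E \<in> sets \<mu>" "E' \<in> sets \<mu>" "emeasure \<mu> E < \<infinity>" "emeasure \<mu> E' < \<infinity>" "E \<inter> E' = {}" for E E'
    using X that by (simp add: uncorrelated_random_measure_def)
  have XX: "(\<integral>\<omega>. X (A z) \<omega> * cnj (X (A w) \<omega>) \<partial>M) = 0" if "z \<in> I" "w \<in> I" "z \<noteq> w" for z w
  proof -
    have "A z \<inter> A w = {}" using that by (auto simp: A_def)
    then have "complex_covariance M (X (A z)) (X (A w)) = 0"
      by (rule uncorr[OF A(1)[OF that(1)] A(1)[OF that(2)] A(2)[OF that(1)] A(2)[OF that(2)]])
    then show ?thesis using X0 that by (simp add: complex_covariance_def)
  qed
  have Dm [measurable]: "D \<in> borel_measurable M" and D2: "integrable M (\<lambda>\<omega>. (D \<omega>)\<^sup>2)"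
    using D by (auto simp: finite_second_moment_def)
  have DX': "(\<integral>\<omega>. of_real (D \<omega>) * cnj (X (A z) \<omega>) \<partial>M) = 0" if z: "z \<in> I" for z
  proof -
    define m where "m = (\<integral>\<omega>. complex_of_real (D \<omega>) \<partial>M)"
    have i1: "integrable M (\<lambda>\<omega>. complex_of_real (D \<omega>) * cnj (X (A z) \<omega>))"
      using D2 by (intro mean_square_product_integrable X2 z) (auto intro: Xm z)
    have i2: "integrable M (\<lambda>\<omega>. m * cnj (X (A z) \<omega>))"
      using mean_square_product_integrable[of "\<lambda>_. 1" M "X (A z)"] X2 Xm z by auto
    have "(\<integral>\<omega>. cnj (X (A z) \<omega>) \<partial>M) = 0" using X0[OF z] by simp
    have "0 = (\<integral>\<omega>. (of_real (D \<omega>) - m) * cnj (X (A z) \<omega>) \<partial>M)"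
    proof -
      have "complex_covariance M (\<lambda>\<omega>. complex_of_real (D \<omega>)) (X (A z)) = 0" using DX A[OF z] by blast
      then show ?thesis unfolding complex_covariance_def X0[OF z] m_def[symmetric] by simp
    qed
    also have "\<dots> = (\<integral>\<omega>. of_real (D \<omega>) * cnj (X (A z) \<omega>) - m * cnj (X (A z) \<omega>) \<partial>M)"
      by (simp add: algebra_simps)
    also have "\<dots> = (\<integral>\<omega>. of_real (D \<omega>) * cnj (X (A z) \<omega>) \<partial>M) - (\<integral>\<omega>. m * cnj (X (A z) \<omega>) \<partial>M)"
      by (rule Bochner_Integration.integral_diff[OF i1 i2])
    also have "(\<integral>\<omega>. m * cnj (X (A z) \<omega>) \<partial>M) = m * (\<integral>\<omega>. cnj (X (A z) \<omega>) \<partial>M)"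
      by (rule integral_mult_right_zero)
    finally show ?thesis using X0[OF z] by simp
  qed
  have XD': "(\<integral>\<omega>. X (A z) \<omega> * of_real (D \<omega>) \<partial>M) = 0" if z: "z \<in> I" for z
  proof -
    have "(\<integral>\<omega>. X (A z) \<omega> * of_real (D \<omega>) \<partial>M) = (\<integral>\<omega>. cnj (of_real (D \<omega>) * cnj (X (A z) \<omega>)) \<partial>M)"
      by (simp add: mult.commute)
    also have "\<dots> = cnj (\<integral>\<omega>. of_real (D \<omega>) * cnj (X (A z) \<omega>) \<partial>M)" by (rule Bochner_Integration.integral_cnj)
    finally show ?thesis using DX'[OF z] by simp
  qed
  show "simple_stochastic_integral \<mu> X s \<in> borel_measurable M"
    unfolding S[abs_def] by measurable
  \<comment> \<open>The index \<open>None\<close> stands for the drift term, so that all terms form one orthogonal family.\<close>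
  define W where "W i \<omega> = (case i of None \<Rightarrow> of_real (D \<omega> * c) | Some z \<Rightarrow> z * X (A z) \<omega>)" for i \<omega>
  define J where "J = insert None (Some ` I)"
  have J: "finite J" using I by (simp add: J_def)
  have sumJ: "(\<Sum>i\<in>J. h i) = h None + (\<Sum>z\<in>I. h (Some z))" for h :: "complex option \<Rightarrow> 'b::comm_monoid_add"
    using I by (simp add: J_def sum.reindex)
  have sumW: "(\<Sum>i\<in>J. W i \<omega>) = of_real (D \<omega> * c) + simple_stochastic_integral \<mu> X s \<omega>" for \<omega>
    by (simp add: sumJ W_def S)
  have Wm: "W i \<in> borel_measurable M" if "i \<in> J" for i
    using that Xm by (auto simp: J_def W_def[abs_def])
  have W2: "integrable M (\<lambda>\<omega>. (cmod (W i \<omega>))\<^sup>2)" if "i \<in> J" for i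
    using that X2 D2 by (auto simp: J_def W_def norm_mult power_mult_distrib)
  have W0: "(\<integral>\<omega>. W i \<omega> * cnj (W j \<omega>) \<partial>M) = 0" if ij: "i \<in> J" "j \<in> J" "i \<noteq> j" for i j
  proof -
    consider z where "i = None" "j = Some z" "z \<in> I" | z where "i = Some z" "j = None" "z \<in> I"
      | z w where "i = Some z" "j = Some w" "z \<in> I" "w \<in> I" "z \<noteq> w"
      using ij by (auto simp: J_def)
    then show ?thesis
    proof cases
      case (1 z)
      then have "(\<integral>\<omega>. W i \<omega> * cnj (W j \<omega>) \<partial>M) = (\<integral>\<omega>. (of_real c * cnj z) * (of_real (D \<omega>) * cnj (X (A z) \<omega>)) \<partial>M)"
        by (simp add: W_def mult_ac)
      also have "\<dots> = (of_real c * cnj z) * (\<integral>\<omega>. of_real (D \<omega>) * cnj (X (A z) \<omega>) \<partial>M)"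
        by (rule integral_mult_right_zero)
      finally show ?thesis using DX'[OF 1(3)] by simp
    next
      case (2 z)
      then have "(\<integral>\<omega>. W i \<omega> * cnj (W j \<omega>) \<partial>M) = (\<integral>\<omega>. (of_real c * z) * (X (A z) \<omega> * of_real (D \<omega>)) \<partial>M)"
        by (simp add: W_def mult_ac)
      also have "\<dots> = (of_real c * z) * (\<integral>\<omega>. X (A z) \<omega> * of_real (D \<omega>) \<partial>M)"
        by (rule integral_mult_right_zero)
      finally show ?thesis using XD'[OF 2(3)] by simp
    next
      case (3 z w)
      then have "(\<integral>\<omega>. W i \<omega> * cnj (W j \<omega>) \<partial>M) = (\<integral>\<omega>. (z * cnj w) * (X (A z) \<omega> * cnj (X (A w) \<omega>)) \<partial>M)"
        by (simp add: W_def mult_ac)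
      also have "\<dots> = (z * cnj w) * (\<integral>\<omega>. X (A z) \<omega> * cnj (X (A w) \<omega>) \<partial>M)"
        by (rule integral_mult_right_zero)
      finally show ?thesis using XX 3 by simp
    qed
  qed
  show "integrable M (\<lambda>\<omega>. (cmod (of_real (D \<omega> * c) + simple_stochastic_integral \<mu> X s \<omega>))\<^sup>2)"
    using orthogonal_sum(1)[of J W M, OF J Wm W2 W0] unfolding sumW by simp
  have "(\<integral>\<omega>. (cmod (of_real (D \<omega> * c) + simple_stochastic_integral \<mu> X s \<omega>))\<^sup>2 \<partial>M) = (\<Sum>i\<in>J. \<integral>\<omega>. (cmod (W i \<omega>))\<^sup>2 \<partial>M)"
    using orthogonal_sum(2)[of J W M, OF J Wm W2 W0] unfolding sumW by simp
  also have "\<dots> = (\<integral>\<omega>. (D \<omega>)\<^sup>2 * c\<^sup>2 \<partial>M) + (\<Sum>z\<in>I. \<integral>\<omega>. (cmod z)\<^sup>2 * (cmod (X (A z) \<omega>))\<^sup>2 \<partial>M)"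
    by (simp add: sumJ W_def norm_mult power_mult_distrib)
  also have "\<dots> = c\<^sup>2 * (\<integral>\<omega>. (D \<omega>)\<^sup>2 \<partial>M) + (\<Sum>z\<in>I. (cmod z)\<^sup>2 * measure \<mu> (A z))"
    by (simp add: X\<mu> mult.commute)
  also have "(\<Sum>z\<in>I. (cmod z)\<^sup>2 * measure \<mu> (A z)) = (\<integral>u. (cmod (s u))\<^sup>2 \<partial>\<mu>)"
    by (simp add: integral_simple_norm_square(2)[OF s fin] I_def A_def)
  finally show "(\<integral>\<omega>. (cmod (of_real (D \<omega> * c) + simple_stochastic_integral \<mu> X s \<omega>))\<^sup>2 \<partial>M) =
        c\<^sup>2 * (\<integral>\<omega>. (D \<omega>)\<^sup>2 \<partial>M) + (\<integral>u. (cmod (s u))\<^sup>2 \<partial>\<mu>)" .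
qed

lemma cmod_exp_minus_1: "(cmod (exp (\<i> * of_real x) - 1))\<^sup>2 = 2 - 2 * cos x"
proof -
  have "(cmod (exp (\<i> * of_real x) - 1))\<^sup>2 = (cos x - 1)\<^sup>2 + (sin x)\<^sup>2"
    by (simp add: cis_conv_exp[symmetric] cmod_power2)
  also have "\<dots> = 2 - 2 * cos x"
    using sin_cos_squared_add[of x] by (simp add: power2_eq_square algebra_simps)
  finally show ?thesis .
qed

text \<open>The mean square of an increment over lag \<open>r\<close>, with \<open>\<bar>exp (i r u) - 1\<bar>\<^sup>2\<close> written as
  \<open>2 - 2 cos (r u)\<close>; \<open>d\<close> is the second moment of the drift.\<close>

definition structure_function :: "real \<Rightarrow> real measure \<Rightarrow> real \<Rightarrow> real" where
  "structure_function d \<mu> r = r\<^sup>2 * d + (\<integral>u. 2 - 2 * cos (r * u) \<partial>\<mu>)"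

text \<open>The simple approximations of the integrand converge on both sides of the isometry for simple
  integrands: in \<open>L\<^sub>2(M)\<close>, with the drift added, to \<open>B t\<close>, and in \<open>L\<^sub>2(\<mu>)\<close> to \<open>exp (i t u) - 1\<close>.\<close>

lemma
  assumes M: "prob_space M" and rep: "spectral_representation M B D\<^sub>0 X \<mu>"
    and B[measurable]: "B t \<in> borel_measurable M"
  shows spectral_second_moment:
      "(\<integral>\<omega>. (B t \<omega>)\<^sup>2 \<partial>M) = structure_function (\<integral>\<omega>. (D\<^sub>0 \<omega>)\<^sup>2 \<partial>M) \<mu> t"
    and spectral_integrable: "integrable \<mu> (\<lambda>u. 2 - 2 * cos (t * u))"
proof -
  have X: "uncorrelated_random_measure M \<mu> X" and D: "finite_second_moment M D\<^sub>0"
    and DX: "\<forall>A\<in>sets \<mu>. emeasure \<mu> A < \<infinity> \<longrightarrow> complex_covariance M (\<lambda>\<omega>. complex_of_real (D\<^sub>0 \<omega>)) (X A) = 0"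
    and int: "has_stochastic_integral M \<mu> X (\<lambda>u. exp (\<i> * of_real (t * u)) - 1) (\<lambda>\<omega>. of_real (B t \<omega> - D\<^sub>0 \<omega> * t))"
    using rep by (auto simp: spectral_representation_def)
  have [measurable]: "D\<^sub>0 \<in> borel_measurable M" using D by (simp add: finite_second_moment_def)
  define g where "g u = exp (\<i> * of_real (t * u)) - 1" for u
  obtain s where g[measurable]: "g \<in> borel_measurable \<mu>"
    and s: "\<And>n::nat. simple_function \<mu> (s n)" and fin: "\<And>n. emeasure \<mu> {u \<in> space \<mu>. s n u \<noteq> 0} < \<infinity>"
    and lim1: "(\<lambda>n. \<integral>\<^sup>+u. ennreal ((cmod (g u - s n u))\<^sup>2) \<partial>\<mu>) \<longlonglongrightarrow> 0"
    and lim2: "(\<lambda>n. \<integral>\<^sup>+\<omega>. ennreal ((cmod (of_real (B t \<omega> - D\<^sub>0 \<omega> * t) - simple_stochastic_integral \<mu> X (s n) \<omega>))\<^sup>2) \<partial>M) \<longlonglongrightarrow> 0"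
    using int unfolding has_stochastic_integral_def g_def[symmetric] by auto
  have sm: "s n \<in> borel_measurable \<mu>" for n by (rule borel_measurable_simple_function[OF s])
  have Sm [measurable]: "simple_stochastic_integral \<mu> X (s n) \<in> borel_measurable M" for n
    by (rule simple_stochastic_integral_measurable[OF M X D DX s fin])
  note l1 = mean_square_limit[OF g sm integral_simple_norm_square(1)[OF s fin] lim1]
  have "(\<lambda>n. \<integral>\<^sup>+\<omega>. ennreal ((norm (complex_of_real (B t \<omega>) - (of_real (D\<^sub>0 \<omega> * t) + simple_stochastic_integral \<mu> X (s n) \<omega>)))\<^sup>2) \<partial>M) \<longlonglongrightarrow> 0"
    using lim2 by (simp add: algebra_simps)
  from mean_square_limit(2)[OF _ _ simple_stochastic_integral_square_integrable[OF M X D DX s fin] this]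
  have "(\<lambda>n. \<integral>\<omega>. (cmod (of_real (D\<^sub>0 \<omega> * t) + simple_stochastic_integral \<mu> X (s n) \<omega>))\<^sup>2 \<partial>M)
      \<longlonglongrightarrow> (\<integral>\<omega>. (cmod (of_real (B t \<omega>)))\<^sup>2 \<partial>M)"
    by measurable
  then have "(\<lambda>n. t\<^sup>2 * (\<integral>\<omega>. (D\<^sub>0 \<omega>)\<^sup>2 \<partial>M) + (\<integral>u. (cmod (s n u))\<^sup>2 \<partial>\<mu>)) \<longlonglongrightarrow> (\<integral>\<omega>. (B t \<omega>)\<^sup>2 \<partial>M)"
    by (simp only: simple_stochastic_integral_isometry[OF M X D DX s fin] norm_of_real power2_abs)
  moreover have "(\<lambda>n. t\<^sup>2 * (\<integral>\<omega>. (D\<^sub>0 \<omega>)\<^sup>2 \<partial>M) + (\<integral>u. (cmod (s n u))\<^sup>2 \<partial>\<mu>))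
      \<longlonglongrightarrow> t\<^sup>2 * (\<integral>\<omega>. (D\<^sub>0 \<omega>)\<^sup>2 \<partial>M) + (\<integral>u. (cmod (g u))\<^sup>2 \<partial>\<mu>)"
    by (intro tendsto_intros l1)
  ultimately have "(\<integral>\<omega>. (B t \<omega>)\<^sup>2 \<partial>M) = t\<^sup>2 * (\<integral>\<omega>. (D\<^sub>0 \<omega>)\<^sup>2 \<partial>M) + (\<integral>u. (cmod (g u))\<^sup>2 \<partial>\<mu>)"
    by (rule LIMSEQ_unique)
  then show "(\<integral>\<omega>. (B t \<omega>)\<^sup>2 \<partial>M) = structure_function (\<integral>\<omega>. (D\<^sub>0 \<omega>)\<^sup>2 \<partial>M) \<mu> t"
    by (simp only: structure_function_def g_def cmod_exp_minus_1)
  show "integrable \<mu> (\<lambda>u. 2 - 2 * cos (t * u))"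
    using l1(1) by (simp only: g_def cmod_exp_minus_1)
qed

text \<open>Mean and variance of an increment do not depend on its starting point, hence neither does the
  second moment, and the increment starting at \<open>0\<close> is \<open>B r\<close> itself.\<close>

lemma second_moment_increment:
  assumes M: "prob_space M" and st: "wide_sense_stationary_increments M B"
    and B0: "AE \<omega> in M. B 0 \<omega> = 0"
  shows "(\<integral>\<omega>. (B (t\<^sub>0 + r) \<omega> - B t\<^sub>0 \<omega>)\<^sup>2 \<partial>M) = (\<integral>\<omega>. (B r \<omega>)\<^sup>2 \<partial>M)"
    and "integrable M (\<lambda>\<omega>. (B (t\<^sub>0 + r) \<omega> - B t\<^sub>0 \<omega>)\<^sup>2)"
proof -
  interpret prob_space M by fact
  have Bm [measurable]: "B t \<in> borel_measurable M" and B2: "integrable M (\<lambda>\<omega>. (B t \<omega>)\<^sup>2)" for t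
    using st by (auto simp: wide_sense_stationary_increments_def finite_second_moment_def)
  obtain m K where m: "\<And>t\<^sub>0 t. (LINT \<omega>|M. B (t\<^sub>0 + t) \<omega> - B t\<^sub>0 \<omega>) = m t"
    and K: "\<And>t\<^sub>0 s t. covariance M (\<lambda>\<omega>. B (t\<^sub>0 + s) \<omega> - B t\<^sub>0 \<omega>) (\<lambda>\<omega>. B (t\<^sub>0 + t) \<omega> - B t\<^sub>0 \<omega>) = K s t"
    using st unfolding wide_sense_stationary_increments_def by blast
  have i2: "integrable M (\<lambda>\<omega>. (B (t + r) \<omega> - B t \<omega>)\<^sup>2)" for t
    by (rule integrable_square_diff[OF Bm Bm B2 B2])
  have i1: "integrable M (\<lambda>\<omega>. B (t + r) \<omega> - B t \<omega>)" for t
    by (rule square_integrable_imp_integrable[OF _ i2]) measurable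
  have *: "(\<integral>\<omega>. (B (t + r) \<omega> - B t \<omega>)\<^sup>2 \<partial>M) = K r r + (m r)\<^sup>2" for t
  proof -
    have "K r r = (\<integral>\<omega>. (B (t + r) \<omega> - B t \<omega>)\<^sup>2 - 2 * m r * (B (t + r) \<omega> - B t \<omega>) + (m r)\<^sup>2 \<partial>M)"
      unfolding K[of t, symmetric] covariance_def m
      by (intro Bochner_Integration.integral_cong) (auto simp: power2_eq_square algebra_simps)
    also have "\<dots> = (\<integral>\<omega>. (B (t + r) \<omega> - B t \<omega>)\<^sup>2 \<partial>M) - 2 * m r * (\<integral>\<omega>. B (t + r) \<omega> - B t \<omega> \<partial>M) + (m r)\<^sup>2"
      using i2 i1 by (simp add: prob_space del: integral_diff)
    finally show ?thesis by (simp add: m power2_eq_square)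
  qed
  have "(\<integral>\<omega>. (B (0 + r) \<omega> - B 0 \<omega>)\<^sup>2 \<partial>M) = (\<integral>\<omega>. (B r \<omega>)\<^sup>2 \<partial>M)"
    by (rule integral_cong_AE) (use B0 in auto)
  then show "(\<integral>\<omega>. (B (t\<^sub>0 + r) \<omega> - B t\<^sub>0 \<omega>)\<^sup>2 \<partial>M) = (\<integral>\<omega>. (B r \<omega>)\<^sup>2 \<partial>M)"
    using *[of t\<^sub>0] *[of 0] by simp
  show "integrable M (\<lambda>\<omega>. (B (t\<^sub>0 + r) \<omega> - B t\<^sub>0 \<omega>)\<^sup>2)" by (rule i2)
qed

section \<open>The lag weight\<close>

lemma nn_integral_Leb:
  assumes "f \<in> borel_measurable borel"
  shows "(\<integral>\<^sup>+x. f x \<partial>Leb T) = (\<integral>\<^sup>+x. f x * indicator {0..T} x \<partial>lborel)"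
proof -
  have "(\<integral>\<^sup>+x. f x \<partial>Leb T) = (\<integral>\<^sup>+x. f x * indicator {0..T} x \<partial>lebesgue)"
    by (rule nn_integral_restrict_space) auto
  then show ?thesis by (simp add: nn_integral_completion)
qed

text \<open>The integral of \<open>green T t (t + r)\<close> over all \<open>t\<close> with \<open>t\<close> and \<open>t + r\<close> in \<open>[0, T]\<close>, divided by \<open>T\<close>
  (see \<open>nn_integral_green_diagonal\<close>).\<close>

definition lag_weight :: "real \<Rightarrow> real \<Rightarrow> real" where
  "lag_weight T r = (if 0 \<le> r \<and> r \<le> T then ((T - r) * cosh (T - r) + sinh (T - r)) / (2 * T * sinh T) else 0)"

lemma lag_weight_measurable [measurable]: "lag_weight T \<in> borel_measurable borel"
  unfolding lag_weight_def[abs_def] by measurable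

lemma lag_weight_nonneg: "0 \<le> lag_weight T r"
  by (auto simp: lag_weight_def intro!: divide_nonneg_nonneg add_nonneg_nonneg mult_nonneg_nonneg)

lemma lag_weight_bound:
  assumes "1 \<le> T"
  shows "lag_weight T r \<le> 4 * exp (- r)"
proof (cases "0 \<le> r \<and> r \<le> T")
  case True
  define x where "x = T - r"
  have x: "0 \<le> x" "x \<le> T" using True by (auto simp: x_def)
  have ch: "cosh x \<le> exp x" "sinh x \<le> exp x"
  proof -
    have "exp (- x) \<le> exp x" "0 < exp (- x)" "0 < exp x" using x by auto
    then show "cosh x \<le> exp x" and "sinh x \<le> exp x" by (auto simp only: cosh_field_def sinh_field_def field_simps)
  qed
  have "x * cosh x + sinh x \<le> T * exp x + T * exp x"
  proof (rule add_mono)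
    show "x * cosh x \<le> T * exp x" using x ch by (intro mult_mono) auto
    have "sinh x \<le> 1 * exp x" using ch by simp
    also have "\<dots> \<le> T * exp x" using assms by (intro mult_right_mono) auto
    finally show "sinh x \<le> T * exp x" .
  qed
  also have "\<dots> \<le> 4 * exp (- r) * (2 * T * sinh T)"
  proof -
    have "1 + T \<le> exp T" by (rule exp_ge_add_one_self)
    then have "exp (- T) \<le> 1" "2 \<le> exp T" using assms by (simp, linarith)
    moreover have "a \<le> 4 * ((a - b) / 2)" if "b \<le> 1" "2 \<le> a" for a b :: real
      using that by simp
    ultimately have "exp T \<le> 4 * sinh T" unfolding sinh_field_def by blast
    then have "(2 * T * exp (- r)) * exp T \<le> (2 * T * exp (- r)) * (4 * sinh T)"
      using assms by (intro mult_left_mono) auto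
    moreover have "exp x = exp (- r) * exp T" by (simp add: x_def flip: exp_add)
    ultimately show ?thesis by (simp add: mult_ac)
  qed
  finally have "(x * cosh x + sinh x) / (2 * T * sinh T) \<le> 4 * exp (- r)"
    using assms by (subst pos_divide_le_eq) auto
  then show ?thesis using True by (simp add: lag_weight_def x_def)
next
  case False
  then show ?thesis by (auto simp: lag_weight_def)
qed

lemma lag_weight_tendsto:
  "((\<lambda>T. lag_weight T r) \<longlongrightarrow> (if 0 \<le> r then exp (- r) / 2 else 0)) at_top"
proof (cases "0 \<le> r")
  case True
  have "((\<lambda>T. ((T - r) * cosh (T - r) + sinh (T - r)) / (2 * T * sinh T)) \<longlongrightarrow> inverse (exp r) / 2) at_top"
    unfolding cosh_field_def sinh_field_def by real_asymp
  moreover have "eventually (\<lambda>T. ((T - r) * cosh (T - r) + sinh (T - r)) / (2 * T * sinh T) = lag_weight T r) at_top"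
    using eventually_ge_at_top[of r] by eventually_elim (use True in \<open>simp add: lag_weight_def\<close>)
  ultimately have "((\<lambda>T. lag_weight T r) \<longlongrightarrow> inverse (exp r) / 2) at_top"
    by (rule Lim_transform_eventually)
  then show ?thesis using True by (simp add: exp_minus)
qed (simp add: lag_weight_def)

lemma nn_integral_green_diagonal:
  assumes T: "T > 0" and r: "0 \<le> r" "r \<le> T"
  shows "(\<integral>\<^sup>+t. ennreal (green T t (t + r)) * indicator {0..T - r} t \<partial>lborel) = ennreal (T * lag_weight T r)"
proof -
  define c where "c = T - r"
  define F where "F t = (t * cosh c + sinh (2 * t - c) / 2) / (2 * sinh T)" for t
  have S: "sinh T > 0" using T by simp
  have eq: "green T t (t + r) = (cosh c + cosh (2 * t - c)) / (2 * sinh T)" for t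
  proof -
    have "cosh c = cosh t * cosh (c - t) + sinh t * sinh (c - t)" using cosh_add[of t "c - t"] by simp
    moreover have "cosh (2 * t - c) = cosh t * cosh (c - t) - sinh t * sinh (c - t)"
      using cosh_diff[of t "c - t"] by (simp add: algebra_simps)
    ultimately have "cosh c + cosh (2 * t - c) = 2 * (cosh t * cosh (c - t))" by simp
    moreover have "green T t (t + r) = cosh t * cosh (c - t) / sinh T"
      using r by (simp add: green_eq[OF T] min_def max_def c_def algebra_simps)
    ultimately show ?thesis by simp
  qed
  have "(\<integral>\<^sup>+t. ennreal (green T t (t + r)) * indicator {0..c} t \<partial>lborel) = F c - F 0"
  proof (rule nn_integral_FTC_Icc)
    show "(\<lambda>t. green T t (t + r)) \<in> borel_measurable borel"
      unfolding eq by measurable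
    fix t
    show "(F has_real_derivative green T t (t + r)) (at t)"
      unfolding eq F_def using S by (auto intro!: derivative_eq_intros simp: field_simps)
  qed (use r green_nonneg[OF T] in \<open>auto simp: c_def\<close>)
  also have "F c - F 0 = (c * cosh c + sinh c) / (2 * sinh T)"
    using S by (simp add: F_def field_simps)
  also have "\<dots> = T * lag_weight T r"
    using T r by (simp add: lag_weight_def c_def)
  finally show ?thesis by (simp add: c_def)
qed

text \<open>The integrand is symmetric, so the square is twice the triangle \<open>t \<le> s\<close>; there the substitution
  \<open>s = t + r\<close> and Tonelli collect the pairs with the same lag.\<close>

lemma green_stationary_form:
  fixes V :: "real \<Rightarrow> real"
  assumes T: "T > 0" and V[measurable]: "V \<in> borel_measurable borel"
    and V0: "V 0 = 0" and Vnn: "\<And>r. 0 \<le> V r"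
  shows "(\<integral>\<^sup>+t. \<integral>\<^sup>+s. ennreal (green T t s * V \<bar>t - s\<bar>) \<partial>Leb T \<partial>Leb T) =
    2 * (\<integral>\<^sup>+r. ennreal (T * lag_weight T r * V r) \<partial>lborel)"
proof -
  define \<Phi> :: "real \<Rightarrow> real \<Rightarrow> ennreal" where
    "\<Phi> t s = ennreal (green T t s * V \<bar>t - s\<bar>) * indicator {0..T} t * indicator {0..T} s" for t s
  have [measurable]: "(\<lambda>(t, s). \<Phi> t s) \<in> borel_measurable (borel \<Otimes>\<^sub>M borel)"
    unfolding \<Phi>_def by measurable
  have sym: "\<Phi> t s = \<Phi> s t" for t s
    by (simp add: \<Phi>_def green_commute[OF T, of t s] abs_minus_commute mult_ac)
  have "(\<integral>\<^sup>+t. \<integral>\<^sup>+s. ennreal (green T t s * V \<bar>t - s\<bar>) \<partial>Leb T \<partial>Leb T)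
     = (\<integral>\<^sup>+t. (\<integral>\<^sup>+s. ennreal (green T t s * V \<bar>t - s\<bar>) * indicator {0..T} s \<partial>lborel) * indicator {0..T} t \<partial>lborel)"
    by (simp add: nn_integral_Leb)
  also have "\<dots> = (\<integral>\<^sup>+t. \<integral>\<^sup>+s. \<Phi> t s \<partial>lborel \<partial>lborel)"
  proof (rule nn_integral_cong)
    fix t :: real
    have "(\<integral>\<^sup>+s. ennreal (green T t s * V \<bar>t - s\<bar>) * indicator {0..T} s \<partial>lborel) * indicator {0..T} t
       = (\<integral>\<^sup>+s. (ennreal (green T t s * V \<bar>t - s\<bar>) * indicator {0..T} s) * indicator {0..T} t \<partial>lborel)"
      by (rule nn_integral_multc[symmetric]) measurable
    also have "\<dots> = (\<integral>\<^sup>+s. \<Phi> t s \<partial>lborel)"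
      by (intro nn_integral_cong) (simp add: \<Phi>_def mult_ac)
    finally show "(\<integral>\<^sup>+s. ennreal (green T t s * V \<bar>t - s\<bar>) * indicator {0..T} s \<partial>lborel) * indicator {0..T} t
       = (\<integral>\<^sup>+s. \<Phi> t s \<partial>lborel)" .
  qed
  also have "\<dots> = (\<integral>\<^sup>+t. \<integral>\<^sup>+s. \<Phi> t s * indicator {t..} s + \<Phi> s t * indicator {s..} t \<partial>lborel \<partial>lborel)"
  proof (intro nn_integral_cong)
    fix t s :: real
    \<comment> \<open>Both triangles contain the diagonal; it is harmless because \<open>V 0 = 0\<close>.\<close>
    show "\<Phi> t s = \<Phi> t s * indicator {t..} s + \<Phi> s t * indicator {s..} t"
      using sym[of t s] by (cases t s rule: linorder_cases) (auto simp: indicator_def \<Phi>_def V0)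
  qed
  also have "\<dots> = (\<integral>\<^sup>+t. (\<integral>\<^sup>+s. \<Phi> t s * indicator {t..} s \<partial>lborel) + (\<integral>\<^sup>+s. \<Phi> s t * indicator {s..} t \<partial>lborel) \<partial>lborel)"
    by (intro nn_integral_cong nn_integral_add) (auto simp: indicator_def)
  also have "\<dots> = (\<integral>\<^sup>+t. \<integral>\<^sup>+s. \<Phi> t s * indicator {t..} s \<partial>lborel \<partial>lborel) + (\<integral>\<^sup>+t. \<integral>\<^sup>+s. \<Phi> s t * indicator {s..} t \<partial>lborel \<partial>lborel)"
    by (intro nn_integral_add) (auto simp: indicator_def)
  also have "(\<integral>\<^sup>+t. \<integral>\<^sup>+s. \<Phi> s t * indicator {s..} t \<partial>lborel \<partial>lborel) = (\<integral>\<^sup>+t. \<integral>\<^sup>+s. \<Phi> t s * indicator {t..} s \<partial>lborel \<partial>lborel)"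
    by (rule lborel_pair.Fubini') (simp add: indicator_def)
  also have "(\<integral>\<^sup>+t. \<integral>\<^sup>+s. \<Phi> t s * indicator {t..} s \<partial>lborel \<partial>lborel)
      = (\<integral>\<^sup>+t. \<integral>\<^sup>+r. \<Phi> t (t + r) * indicator {t..} (t + r) \<partial>lborel \<partial>lborel)"
  proof (rule nn_integral_cong)
    fix t :: real
    show "(\<integral>\<^sup>+s. \<Phi> t s * indicator {t..} s \<partial>lborel) = (\<integral>\<^sup>+r. \<Phi> t (t + r) * indicator {t..} (t + r) \<partial>lborel)"
      using nn_integral_real_affine[of "\<lambda>s. \<Phi> t s * indicator {t..} s" 1 t] by simp
  qed
  also have "\<dots> = (\<integral>\<^sup>+r. \<integral>\<^sup>+t. \<Phi> t (t + r) * indicator {t..} (t + r) \<partial>lborel \<partial>lborel)"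
    by (rule lborel_pair.Fubini'[symmetric]) (simp add: indicator_def)
  also have "\<dots> = (\<integral>\<^sup>+r. ennreal (T * lag_weight T r * V r) \<partial>lborel)"
  proof (rule nn_integral_cong)
    fix r :: real
    show "(\<integral>\<^sup>+t. \<Phi> t (t + r) * indicator {t..} (t + r) \<partial>lborel) = ennreal (T * lag_weight T r * V r)"
    proof (cases "0 \<le> r \<and> r \<le> T")
      case True
      have "(\<integral>\<^sup>+t. \<Phi> t (t + r) * indicator {t..} (t + r) \<partial>lborel) =
          (\<integral>\<^sup>+t. (ennreal (green T t (t + r)) * indicator {0..T - r} t) * ennreal (V r) \<partial>lborel)"
        using True green_nonneg[OF T] Vnn
        by (intro nn_integral_cong) (auto simp: \<Phi>_def indicator_def ennreal_mult)
      also have "\<dots> = (\<integral>\<^sup>+t. ennreal (green T t (t + r)) * indicator {0..T - r} t \<partial>lborel) * ennreal (V r)"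
        by (rule nn_integral_multc) (simp add: green_def)
      also have "\<dots> = ennreal (T * lag_weight T r) * ennreal (V r)"
        using True by (simp add: nn_integral_green_diagonal[OF T])
      also have "\<dots> = ennreal (T * lag_weight T r * V r)"
        using T lag_weight_nonneg Vnn by (simp add: ennreal_mult)
      finally show ?thesis .
    next
      case False
      then have zero: "\<Phi> t (t + r) * indicator {t..} (t + r) = 0" for t
        by (auto simp: \<Phi>_def indicator_def)
      show ?thesis unfolding zero using False by (auto simp: lag_weight_def)
    qed
  qed
  finally show ?thesis by (simp add: mult_2)
qed

section \<open>The Laplace transform of the structure function\<close>

text \<open>The antiderivative \<open>F\<close> is found by integrating the real part of \<open>exp (- r) (1 - exp (i r u))\<close>.\<close>

lemma nn_integral_exp_cos:
  "(\<integral>\<^sup>+r. ennreal (exp (- r) * (1 - cos (r * u))) * indicator {0..} r \<partial>lborel) = ennreal (u\<^sup>2 / (1 + u\<^sup>2))"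
proof -
  have p: "1 + u\<^sup>2 > 0" by (simp add: add_pos_nonneg)
  define F where "F r = - exp (- r) + exp (- r) * (cos (r * u) - u * sin (r * u)) / (1 + u\<^sup>2)" for r
  have "(\<integral>\<^sup>+r. ennreal (exp (- r) * (1 - cos (r * u))) * indicator {0..} r \<partial>lborel) = ennreal (0 - F 0)"
  proof (rule nn_integral_FTC_atLeast)
    fix r :: real
    have E: "((\<lambda>r. - exp (- r)) has_real_derivative exp (- r)) (at r)"
      by (auto intro!: derivative_eq_intros)
    have G: "((\<lambda>r. exp (- r) * (cos (r * u) - u * sin (r * u))) has_real_derivative
        (- exp (- r) * (cos (r * u) - u * sin (r * u)) +
        exp (- r) * (- u * sin (r * u) - u * (u * cos (r * u))))) (at r)"
      by (auto intro!: derivative_eq_intros simp: algebra_simps)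
    have "(F has_real_derivative exp (- r) + (- exp (- r) * (cos (r * u) - u * sin (r * u)) +
        exp (- r) * (- u * sin (r * u) - u * (u * cos (r * u)))) / (1 + u\<^sup>2)) (at r)"
      unfolding F_def by (rule DERIV_add[OF E DERIV_cdivide[OF G]])
    also have "exp (- r) + (- exp (- r) * (cos (r * u) - u * sin (r * u)) +
        exp (- r) * (- u * sin (r * u) - u * (u * cos (r * u)))) / (1 + u\<^sup>2) =
        exp (- r) + (1 + u\<^sup>2) * (- exp (- r) * cos (r * u)) / (1 + u\<^sup>2)"
      by (simp add: power2_eq_square algebra_simps)
    also have "\<dots> = exp (- r) * (1 - cos (r * u))" using p by (simp add: right_diff_distrib)
    finally show "(F has_real_derivative exp (- r) * (1 - cos (r * u))) (at r)" .
    show "0 \<le> exp (- r) * (1 - cos (r * u))" by simp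
  next
    have e: "((\<lambda>r::real. exp (- r)) \<longlongrightarrow> 0) at_top" by real_asymp
    have "((\<lambda>r. exp (- r) * (cos (r * u) - u * sin (r * u))) \<longlongrightarrow> 0) at_top"
    proof (rule Lim_null_comparison)
      show "eventually (\<lambda>r. norm (exp (- r) * (cos (r * u) - u * sin (r * u))) \<le> exp (- r) * (1 + \<bar>u\<bar>)) at_top"
      proof (rule always_eventually, rule allI)
        fix r
        have "\<bar>cos (r * u) - u * sin (r * u)\<bar> \<le> \<bar>cos (r * u)\<bar> + \<bar>u\<bar> * \<bar>sin (r * u)\<bar>"
          using abs_triangle_ineq4[of "cos (r * u)" "u * sin (r * u)"] by (simp add: abs_mult)
        also have "\<dots> \<le> 1 + \<bar>u\<bar> * 1" by (intro add_mono mult_left_mono) auto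
        finally show "norm (exp (- r) * (cos (r * u) - u * sin (r * u))) \<le> exp (- r) * (1 + \<bar>u\<bar>)"
          by (simp add: abs_mult)
      qed
      show "((\<lambda>r. exp (- r) * (1 + \<bar>u\<bar>)) \<longlongrightarrow> 0) at_top"
        using tendsto_mult[OF e tendsto_const[of "1 + \<bar>u\<bar>"]] by simp
    qed
    from tendsto_divide[OF this tendsto_const[of "1 + u\<^sup>2"]]
    show "(F \<longlongrightarrow> 0) at_top" unfolding F_def
      using p tendsto_add[OF tendsto_minus[OF e]] by fastforce
  qed measurable
  also have "0 - F 0 = u\<^sup>2 / (1 + u\<^sup>2)" using p by (simp add: F_def field_simps)
  finally show ?thesis .
qed

text \<open>By Markov's inequality the measure of \<open>\<bar>u\<bar> \<ge> 1 / n\<close> is at most \<open>n\<^sup>2\<close> times the integral of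
  \<open>min (u\<^sup>2) 1\<close>, and these sets exhaust the punctured line.\<close>

lemma spectral_measure_sigma_finite:
  assumes sets: "sets \<mu> = sets (restrict_space borel (- {0 :: real}))"
    and fin: "(\<integral>\<^sup>+u. ennreal (min (u\<^sup>2) 1) \<partial>\<mu>) < \<infinity>"
  shows "sigma_finite_measure \<mu>"
proof
  have sp: "space \<mu> = - {0}" using sets_eq_imp_space_eq[OF sets] by (simp add: space_restrict_space)
  have id[measurable]: "(\<lambda>u. u) \<in> borel_measurable \<mu>"
    using sets by (subst measurable_cong_sets[OF sets refl]) (simp add: measurable_restrict_space1)
  define A where "A n = {u \<in> space \<mu>. 1 / real (Suc n) \<le> \<bar>u\<bar>}" for n
  have A: "A n \<in> sets \<mu>" for n unfolding A_def by measurable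
  have "emeasure \<mu> (A n) < \<infinity>" for n
  proof -
    have "emeasure \<mu> (A n) = (\<integral>\<^sup>+u. indicator (A n) u \<partial>\<mu>)" using A by simp
    also have "\<dots> \<le> (\<integral>\<^sup>+u. ennreal ((real (Suc n))\<^sup>2) * ennreal (min (u\<^sup>2) 1) \<partial>\<mu>)"
    proof (rule nn_integral_mono)
      fix u
      have "1 \<le> (real (Suc n))\<^sup>2 * min (u\<^sup>2) 1" if "u \<in> A n"
      proof -
        have "1 \<le> real (Suc n) * \<bar>u\<bar>" using that by (simp add: A_def field_simps)
        then have "1\<^sup>2 \<le> (real (Suc n) * \<bar>u\<bar>)\<^sup>2" by (intro power_mono) auto
        moreover have "1\<^sup>2 \<le> (real (Suc n))\<^sup>2" by (intro power_mono) auto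
        ultimately show ?thesis by (simp add: power_mult_distrib min_def)
      qed
      then show "indicator (A n) u \<le> ennreal ((real (Suc n))\<^sup>2) * ennreal (min (u\<^sup>2) 1)"
        by (auto simp: indicator_def simp flip: ennreal_mult)
    qed
    also have "\<dots> = ennreal ((real (Suc n))\<^sup>2) * (\<integral>\<^sup>+u. ennreal (min (u\<^sup>2) 1) \<partial>\<mu>)"
      by (rule nn_integral_cmult) measurable
    also have "\<dots> < \<infinity>" using fin by (simp add: ennreal_mult_less_top)
    finally show ?thesis .
  qed
  moreover have "(\<Union>n. A n) = space \<mu>"
  proof -
    have "\<exists>n. 1 / real (Suc n) \<le> \<bar>u\<bar>" if "u \<noteq> 0" for u :: real
      using reals_Archimedean[of "\<bar>u\<bar>"] that by (auto simp: inverse_eq_divide intro: less_imp_le)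
    then show ?thesis by (auto simp: A_def sp)
  qed
  ultimately show "\<exists>A. countable A \<and> A \<subseteq> sets \<mu> \<and> \<Union> A = space \<mu> \<and> (\<forall>a\<in>A. emeasure \<mu> a \<noteq> \<infinity>)"
    using A by (intro exI[of _ "range A"]) (auto simp: less_top)
qed

lemma structure_function_laplace:
  assumes sets: "sets \<mu> = sets (restrict_space borel (- {0 :: real}))"
    and fin: "(\<integral>\<^sup>+u. ennreal (min (u\<^sup>2) 1) \<partial>\<mu>) < \<infinity>"
    and d: "0 \<le> d"
    and int: "\<And>r. integrable \<mu> (\<lambda>u. 2 - 2 * cos (r * u))"
  shows "(\<integral>\<^sup>+r. ennreal (exp (- r) / 2 * structure_function d \<mu> r) * indicator {0..} r \<partial>lborel) =
      ennreal (d + (\<integral>u. u\<^sup>2 / (1 + u\<^sup>2) \<partial>\<mu>))"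
    and "structure_function d \<mu> \<in> borel_measurable borel"
proof -
  have exp_m: "(\<lambda>r. ennreal (r ^ 2 * exp (- r)) * indicator {0..} r) \<in> borel_measurable (lborel :: real measure)"
    by measurable
  interpret S: sigma_finite_measure \<mu> by (rule spectral_measure_sigma_finite[OF sets fin])
  interpret pair_sigma_finite lborel \<mu> ..
  have id[measurable]: "(\<lambda>u. u) \<in> borel_measurable \<mu>"
    using sets by (subst measurable_cong_sets[OF sets refl]) (simp add: measurable_restrict_space1)
  have V: "ennreal (structure_function d \<mu> r) = ennreal (r\<^sup>2 * d) + (\<integral>\<^sup>+u. ennreal (2 - 2 * cos (r * u)) \<partial>\<mu>)" for r
    unfolding structure_function_def using d int
    by (simp add: ennreal_plus nn_integral_eq_integral)
  have nn: "0 \<le> structure_function d \<mu> r" for r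
    unfolding structure_function_def using d by (intro add_nonneg_nonneg integral_nonneg_AE) auto
  have "(\<lambda>r. \<integral>u. 2 - 2 * cos (r * u) \<partial>\<mu>) \<in> borel_measurable borel"
    by measurable
  then show "structure_function d \<mu> \<in> borel_measurable borel"
    unfolding structure_function_def[abs_def] by measurable
  have joint_m: "(\<lambda>(r, u). ennreal (exp (- r) * (1 - cos (r * u))) * indicator {0..} r) \<in> borel_measurable (lborel \<Otimes>\<^sub>M \<mu>)"
    by measurable
  have inner_m: "(\<lambda>r. \<integral>\<^sup>+u. ennreal (exp (- r) * (1 - cos (r * u))) * indicator {0..} r \<partial>\<mu>) \<in> borel_measurable lborel"
    using S.borel_measurable_nn_integral[OF joint_m] by simp
  have "(\<integral>\<^sup>+r. ennreal (exp (- r) / 2 * structure_function d \<mu> r) * indicator {0..} r \<partial>lborel)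
     = (\<integral>\<^sup>+r. ennreal (d / 2) * (ennreal (r ^ 2 * exp (- r)) * indicator {0..} r) +
          (\<integral>\<^sup>+u. ennreal (exp (- r) * (1 - cos (r * u))) * indicator {0..} r \<partial>\<mu>) \<partial>lborel)"
  proof (intro nn_integral_cong)
    fix r :: real
    have "ennreal (exp (- r) / 2 * structure_function d \<mu> r) =
        ennreal (exp (- r) / 2) * ennreal (r\<^sup>2 * d) + ennreal (exp (- r) / 2) * (\<integral>\<^sup>+u. ennreal (2 - 2 * cos (r * u)) \<partial>\<mu>)"
    proof -
      have "ennreal (exp (- r) / 2 * structure_function d \<mu> r) = ennreal (exp (- r) / 2) * ennreal (structure_function d \<mu> r)"
        by (rule ennreal_mult) (use nn in auto)
      then show ?thesis by (simp only: V distrib_left)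
    qed
    also have "ennreal (exp (- r) / 2) * ennreal (r\<^sup>2 * d) = ennreal (d / 2) * ennreal (r ^ 2 * exp (- r))"
      using d by (simp flip: ennreal_mult add: mult_ac)
    also have "ennreal (exp (- r) / 2) * (\<integral>\<^sup>+u. ennreal (2 - 2 * cos (r * u)) \<partial>\<mu>)
        = (\<integral>\<^sup>+u. ennreal (exp (- r) / 2) * ennreal (2 - 2 * cos (r * u)) \<partial>\<mu>)"
      by (rule nn_integral_cmult[symmetric]) measurable
    also have "\<dots> = (\<integral>\<^sup>+u. ennreal (exp (- r) * (1 - cos (r * u))) \<partial>\<mu>)"
      by (intro nn_integral_cong) (simp flip: ennreal_mult add: algebra_simps)
    finally show "ennreal (exp (- r) / 2 * structure_function d \<mu> r) * indicator {0..} r =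
        ennreal (d / 2) * (ennreal (r ^ 2 * exp (- r)) * indicator {0..} r) +
          (\<integral>\<^sup>+u. ennreal (exp (- r) * (1 - cos (r * u))) * indicator {0..} r \<partial>\<mu>)"
      by (simp add: nn_integral_multc distrib_right mult_ac split: split_indicator)
  qed
  also have "\<dots> = (\<integral>\<^sup>+r. ennreal (d / 2) * (ennreal (r ^ 2 * exp (- r)) * indicator {0..} r) \<partial>lborel) +
      (\<integral>\<^sup>+r. \<integral>\<^sup>+u. ennreal (exp (- r) * (1 - cos (r * u))) * indicator {0..} r \<partial>\<mu> \<partial>lborel)"
    by (rule nn_integral_add[OF borel_measurable_times_ennreal[OF borel_measurable_const exp_m] inner_m])
  also have "(\<integral>\<^sup>+r. ennreal (d / 2) * (ennreal (r ^ 2 * exp (- r)) * indicator {0..} r) \<partial>lborel) = ennreal d"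
  proof -
    have "(\<integral>\<^sup>+r. ennreal (d / 2) * (ennreal (r ^ 2 * exp (- r)) * indicator {0..} r) \<partial>lborel)
        = ennreal (d / 2) * (\<integral>\<^sup>+r. ennreal (r ^ 2 * exp (- r)) * indicator {0..} r \<partial>lborel)"
      by (rule nn_integral_cmult[OF exp_m])
    also have "(\<integral>\<^sup>+r. ennreal (r ^ 2 * exp (- r)) * indicator {0..} r \<partial>lborel) = ennreal 2"
      using nn_intergal_power_times_exp_Ici[of 2] by (simp add: fact_2)
    also have "ennreal (d / 2) * ennreal 2 = ennreal (d / 2 * 2)"
      by (rule ennreal_mult[symmetric]) (use d in auto)
    also have "d / 2 * 2 = d" by simp
    finally show ?thesis .
  qed
  also have "(\<integral>\<^sup>+r. \<integral>\<^sup>+u. ennreal (exp (- r) * (1 - cos (r * u))) * indicator {0..} r \<partial>\<mu> \<partial>lborel)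
      = (\<integral>\<^sup>+u. \<integral>\<^sup>+r. ennreal (exp (- r) * (1 - cos (r * u))) * indicator {0..} r \<partial>lborel \<partial>\<mu>)"
    by (rule Fubini'[symmetric, OF joint_m])
  also have "\<dots> = (\<integral>\<^sup>+u. ennreal (u\<^sup>2 / (1 + u\<^sup>2)) \<partial>\<mu>)"
    by (simp only: nn_integral_exp_cos)
  also have "\<dots> = ennreal (\<integral>u. u\<^sup>2 / (1 + u\<^sup>2) \<partial>\<mu>)"
  proof (rule nn_integral_eq_integral)
    have "u\<^sup>2 / (1 + u\<^sup>2) \<le> min (u\<^sup>2) 1" for u :: real
    proof -
      have p: "1 + u\<^sup>2 > 0" by (simp add: add_pos_nonneg)
      have "u\<^sup>2 * 1 \<le> u\<^sup>2 * (1 + u\<^sup>2)" by (intro mult_left_mono) auto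
      then show ?thesis using p by (simp add: pos_divide_le_eq min_def)
    qed
    then have "(\<integral>\<^sup>+u. ennreal (norm (u\<^sup>2 / (1 + u\<^sup>2))) \<partial>\<mu>) \<le> (\<integral>\<^sup>+u. ennreal (min (u\<^sup>2) 1) \<partial>\<mu>)"
      by (intro nn_integral_mono ennreal_leI) simp
    then show "integrable \<mu> (\<lambda>u. u\<^sup>2 / (1 + u\<^sup>2))"
      using fin by (intro integrableI_bounded) (auto intro: le_less_trans)
  qed simp
  also have "ennreal d + \<dots> = ennreal (d + (\<integral>u. u\<^sup>2 / (1 + u\<^sup>2) \<partial>\<mu>))"
    using d by (simp add: ennreal_plus integral_nonneg_AE)
  finally show "(\<integral>\<^sup>+r. ennreal (exp (- r) / 2 * structure_function d \<mu> r) * indicator {0..} r \<partial>lborel) =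
      ennreal (d + (\<integral>u. u\<^sup>2 / (1 + u\<^sup>2) \<partial>\<mu>))" .
qed

section \<open>The limit of the mean energy\<close>

text \<open>Since the minimal energy is a double integral of squared increments with a nonnegative kernel,
  Tonelli moves the expectation inside, where stationarity leaves a function of the lag.\<close>

lemma expected_min_energy:
  assumes M: "prob_space M" and B: "measurable_process M B" and T: "T > 0"
    and V[measurable]: "V \<in> borel_measurable borel" and V0: "V 0 = 0" and Vnn: "\<And>r. 0 \<le> V r"
    and incr: "\<And>t s. (\<integral>\<^sup>+\<omega>. ennreal ((B t \<omega> - B s \<omega>)\<^sup>2) \<partial>M) = ennreal (V \<bar>t - s\<bar>)"
    and int: "integrable lborel (\<lambda>r. lag_weight T r * V r)"
  shows "(LINT \<omega>|M. energy T (energy_minimizer T (\<lambda>s. B s \<omega>)) (\<lambda>s. B s \<omega>)) = T * (\<integral>r. lag_weight T r * V r \<partial>lborel)"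
proof -
  interpret prob_space M by fact
  interpret L: sigma_finite_measure "Leb T" by (rule sigma_finite_Leb)
  interpret P: pair_sigma_finite M "Leb T" ..
  have id[measurable]: "(\<lambda>x. x) \<in> borel_measurable (Leb T)" by (rule borel_measurable_Leb) simp
  have B'[measurable]: "(\<lambda>(t, \<omega>). B t \<omega>) \<in> borel_measurable (borel \<Otimes>\<^sub>M M)"
    using B by (simp add: measurable_process_def)
  have BL[measurable]: "(\<lambda>(t, \<omega>). B t \<omega>) \<in> borel_measurable (Leb T \<Otimes>\<^sub>M M)"
    by measurable
  have path: "(\<lambda>s. B s \<omega>) \<in> borel_measurable (Leb T)" if "\<omega> \<in> space M" for \<omega>
    using that by measurable
  define Q where "Q \<omega> = (\<integral>\<^sup>+t. \<integral>\<^sup>+s. ennreal (green T t s * (B t \<omega> - B s \<omega>)\<^sup>2) \<partial>Leb T \<partial>Leb T)" for \<omega>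
  have Qm[measurable]: "Q \<in> borel_measurable M"
    unfolding Q_def by measurable
  define I where "I = (\<integral>r. lag_weight T r * V r \<partial>lborel)"
  have I: "0 \<le> I" unfolding I_def using lag_weight_nonneg Vnn by (intro integral_nonneg_AE) auto
  have "(\<integral>\<^sup>+\<omega>. Q \<omega> \<partial>M) = (\<integral>\<^sup>+t. \<integral>\<^sup>+\<omega>. \<integral>\<^sup>+s. ennreal (green T t s * (B t \<omega> - B s \<omega>)\<^sup>2) \<partial>Leb T \<partial>M \<partial>Leb T)"
    unfolding Q_def by (rule P.Fubini'[symmetric]) measurable
  also have "\<dots> = (\<integral>\<^sup>+t. \<integral>\<^sup>+s. \<integral>\<^sup>+\<omega>. ennreal (green T t s * (B t \<omega> - B s \<omega>)\<^sup>2) \<partial>M \<partial>Leb T \<partial>Leb T)"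
    by (intro nn_integral_cong P.Fubini'[symmetric]) measurable
  also have "\<dots> = (\<integral>\<^sup>+t. \<integral>\<^sup>+s. ennreal (green T t s * V \<bar>t - s\<bar>) \<partial>Leb T \<partial>Leb T)"
  proof (intro nn_integral_cong)
    fix t s
    have "(\<integral>\<^sup>+\<omega>. ennreal (green T t s * (B t \<omega> - B s \<omega>)\<^sup>2) \<partial>M) = (\<integral>\<^sup>+\<omega>. ennreal (green T t s) * ennreal ((B t \<omega> - B s \<omega>)\<^sup>2) \<partial>M)"
      by (simp add: ennreal_mult green_nonneg[OF T])
    also have "\<dots> = ennreal (green T t s) * (\<integral>\<^sup>+\<omega>. ennreal ((B t \<omega> - B s \<omega>)\<^sup>2) \<partial>M)"
      by (rule nn_integral_cmult) measurable
    finally show "(\<integral>\<^sup>+\<omega>. ennreal (green T t s * (B t \<omega> - B s \<omega>)\<^sup>2) \<partial>M) = ennreal (green T t s * V \<bar>t - s\<bar>)"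
      by (simp add: incr ennreal_mult green_nonneg[OF T] Vnn)
  qed
  also have "\<dots> = 2 * (\<integral>\<^sup>+r. ennreal (T * lag_weight T r * V r) \<partial>lborel)"
    by (rule green_stationary_form[OF T V V0 Vnn])
  also have "(\<integral>\<^sup>+r. ennreal (T * lag_weight T r * V r) \<partial>lborel) = ennreal (T * I)"
  proof (subst nn_integral_eq_integral)
    show "integrable lborel (\<lambda>r. T * lag_weight T r * V r)"
      using integrable_mult_right[OF int, of T] by (simp add: mult.assoc)
    show "AE r in lborel. 0 \<le> T * lag_weight T r * V r"
      using T lag_weight_nonneg Vnn by (intro AE_I2 mult_nonneg_nonneg) auto
    show "ennreal (\<integral>r. T * lag_weight T r * V r \<partial>lborel) = ennreal (T * I)"
      by (simp add: I_def mult.assoc)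
  qed
  also have "2 * ennreal (T * I) = ennreal (2 * (T * I))"
    by (metis ennreal_mult' ennreal_numeral zero_le_numeral)
  finally have QI: "(\<integral>\<^sup>+\<omega>. Q \<omega> \<partial>M) = ennreal (2 * (T * I))" .
  have "AE \<omega> in M. Q \<omega> \<noteq> \<infinity>"
    by (rule nn_integral_PInf_AE) (simp_all add: QI)
  then have "(\<integral>\<^sup>+\<omega>. ennreal (enn2real (Q \<omega>)) \<partial>M) = (\<integral>\<^sup>+\<omega>. Q \<omega> \<partial>M)"
    by (intro nn_integral_cong_AE) (auto simp: ennreal_enn2real_if)
  then have "(\<integral>\<omega>. enn2real (Q \<omega>) \<partial>M) = 2 * (T * I)"
    using T I by (subst integral_eq_nn_integral) (auto simp: QI)
  moreover have "(LINT \<omega>|M. energy T (energy_minimizer T (\<lambda>s. B s \<omega>)) (\<lambda>s. B s \<omega>)) = (\<integral>\<omega>. enn2real (Q \<omega>) / 2 \<partial>M)"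
    unfolding Q_def by (intro Bochner_Integration.integral_cong refl min_energy_eq[OF T path])
  ultimately show ?thesis by (simp add: I_def)
qed

theorem theorem3p1:
  fixes M :: "'a measure"
    and B :: "real \<Rightarrow> 'a \<Rightarrow> real"
    and D\<^sub>0 :: "'a \<Rightarrow> real"
    and X :: "real set \<Rightarrow> 'a \<Rightarrow> complex"
    and \<mu> :: "real measure"
  assumes "prob_space M"
    and "measurable_process M B"
    and "stochastically_continuous M B"
    and "wide_sense_stationary_increments M B"
    and "AE \<omega> in M. B 0 \<omega> = 0"
    and "spectral_representation M B D\<^sub>0 X \<mu>"
  shows "((\<lambda>T. (1 / T) *
             (LINT \<omega>|M. energy T (energy_minimizer T (\<lambda>s. B s \<omega>)) (\<lambda>s. B s \<omega>)))
           \<longlongrightarrow> (LINT \<omega>|M. \<bar>D\<^sub>0 \<omega>\<bar>\<^sup>2) + (LINT u|\<mu>. u\<^sup>2 / (1 + u\<^sup>2))) at_top"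
proof -
  note M = assms(1) and st = assms(4) and B0 = assms(5) and rep = assms(6)
  interpret prob_space M by fact
  define d where "d = (\<integral>\<omega>. (D\<^sub>0 \<omega>)\<^sup>2 \<partial>M)"
  define V where "V = structure_function d \<mu>"
  have d: "0 \<le> d" by (simp add: d_def)
  have sets: "sets \<mu> = sets (restrict_space borel (- {0 :: real}))"
    and fin: "(\<integral>\<^sup>+u. ennreal (min (u\<^sup>2) 1) \<partial>\<mu>) < \<infinity>"
    using rep by (auto simp: spectral_representation_def)
  have Bm: "B t \<in> borel_measurable M" for t
    using st by (simp add: wide_sense_stationary_increments_def finite_second_moment_def)
  have V_eq: "(\<integral>\<omega>. (B t \<omega>)\<^sup>2 \<partial>M) = V t" for t
    unfolding V_def d_def by (rule spectral_second_moment[OF M rep Bm])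
  have int\<mu>: "integrable \<mu> (\<lambda>u. 2 - 2 * cos (r * u))" for r
    by (rule spectral_integrable[OF M rep Bm])
  note laplace = structure_function_laplace[OF sets fin d int\<mu>]
  have Vm[measurable]: "V \<in> borel_measurable borel" unfolding V_def by (rule laplace(2))
  have V0: "V 0 = 0" by (simp add: V_def structure_function_def)
  have Vnn: "0 \<le> V r" for r unfolding V_eq[symmetric] by simp
  have incr: "(\<integral>\<^sup>+\<omega>. ennreal ((B t \<omega> - B s \<omega>)\<^sup>2) \<partial>M) = ennreal (V \<bar>t - s\<bar>)" for t s
  proof -
    have *: "(\<integral>\<^sup>+\<omega>. ennreal ((B (a + r) \<omega> - B a \<omega>)\<^sup>2) \<partial>M) = ennreal (V r)" for a r
      using second_moment_increment[OF M st B0, of a r] V_eq[of r]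
      by (subst nn_integral_eq_integral) auto
    show ?thesis
    proof (cases "s \<le> t")
      case True
      then show ?thesis using *[of s "t - s"] by simp
    next
      case False
      then show ?thesis using *[of t "s - t"] by (simp add: power2_commute)
    qed
  qed
  \<comment> \<open>The limit integrand; it also dominates the family, up to the factor \<open>8\<close>.\<close>
  define K where "K r = (if 0 \<le> r then exp (- r) / 2 else 0) * V r" for r
  have Km: "K \<in> borel_measurable lborel" unfolding K_def[abs_def] by measurable
  have K_nn: "(\<integral>\<^sup>+r. ennreal (K r) \<partial>lborel) = ennreal (d + (\<integral>u. u\<^sup>2 / (1 + u\<^sup>2) \<partial>\<mu>))"
    unfolding laplace(1)[symmetric] K_def V_def
    by (intro nn_integral_cong) (simp split: split_indicator)
  have K0: "0 \<le> K r" for r using Vnn by (simp add: K_def)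
  have Kint: "integrable lborel K"
    using Km K0 K_nn by (intro integrableI_bounded) auto
  have K_eq: "(\<integral>r. K r \<partial>lborel) = d + (\<integral>u. u\<^sup>2 / (1 + u\<^sup>2) \<partial>\<mu>)"
  proof -
    have "0 \<le> (\<integral>u. u\<^sup>2 / (1 + u\<^sup>2) \<partial>\<mu>)" by (intro integral_nonneg_AE) simp
    then have nn: "0 \<le> d + (\<integral>u. u\<^sup>2 / (1 + u\<^sup>2) \<partial>\<mu>)" using d by simp
    have "(\<integral>r. K r \<partial>lborel) = enn2real (\<integral>\<^sup>+r. ennreal (K r) \<partial>lborel)"
      using Km K0 by (intro integral_eq_nn_integral) auto
    then show ?thesis by (simp only: K_nn enn2real_ennreal[OF nn])
  qed
  have bound: "norm (lag_weight T r * V r) \<le> 8 * K r" if "1 \<le> T" for T r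
  proof -
    have "lag_weight T r \<le> 8 * (if 0 \<le> r then exp (- r) / 2 else 0)"
      using lag_weight_bound[OF that, of r] by (auto simp: lag_weight_def)
    then have "lag_weight T r * V r \<le> 8 * (if 0 \<le> r then exp (- r) / 2 else 0) * V r"
      by (intro mult_right_mono Vnn)
    then show ?thesis using Vnn[of r] lag_weight_nonneg[of T r] by (simp add: K_def)
  qed
  have lim: "((\<lambda>T. \<integral>r. lag_weight T r * V r \<partial>lborel) \<longlongrightarrow> (\<integral>r. K r \<partial>lborel)) at_top"
  proof (rule integral_dominated_convergence_at_top)
    show "integrable lborel (\<lambda>r. 8 * K r)" using Kint by simp
    show "AE r in lborel. ((\<lambda>T. lag_weight T r * V r) \<longlongrightarrow> K r) at_top"
      unfolding K_def by (intro AE_I2 tendsto_mult lag_weight_tendsto tendsto_const)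
    show "eventually (\<lambda>T. AE r in lborel. norm (lag_weight T r * V r) \<le> 8 * K r) at_top"
      using eventually_ge_at_top[of 1] by eventually_elim (rule AE_I2, rule bound)
  qed (use Km in measurable)
  have "eventually (\<lambda>T. (\<integral>r. lag_weight T r * V r \<partial>lborel) =
      (1 / T) * (LINT \<omega>|M. energy T (energy_minimizer T (\<lambda>s. B s \<omega>)) (\<lambda>s. B s \<omega>))) at_top"
    using eventually_ge_at_top[of 1]
  proof eventually_elim
    case (elim T)
    have "integrable lborel (\<lambda>r. lag_weight T r * V r)"
    proof (rule Bochner_Integration.integrable_bound)
      show "integrable lborel (\<lambda>r. 8 * K r)" using Kint by simp
      show "AE r in lborel. norm (lag_weight T r * V r) \<le> norm (8 * K r)"
        using bound[OF elim] by (intro AE_I2) (metis abs_ge_self order_trans real_norm_def)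
    qed measurable
    from expected_min_energy[OF M assms(2) _ Vm V0 Vnn incr this] elim
    show ?case by simp
  qed
  from Lim_transform_eventually[OF lim this] show ?thesis
    by (simp add: K_eq d_def)
qed

end
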